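(* Let $\Sigma:=\{z\in\mathbb C:\ 0\le\mathrm{Im}(z)\le\pi\}$. The Banach space $APH(\Sigma)$ has the metric approximation property.
   Context: $C_b(\Sigma)$ is the Banach space of bounded continuous complex-valued functions on $\Sigma$ with the sup-norm. $APH(\Sigma)\subset C_b(\Sigma)$ is the Banach space, with the sup-norm, of functions $f\in C_b(\Sigma)$ that are holomorphic in the interior of $\Sigma$ and whose family of shifts $\{S_xf\}_{x\in\mathbb R}$, $S_xf(z):=f(z+x)$, is relatively compact in $C_b(\Sigma)$. A Banach space $B$ has the metric approximation property if for every compact set $K\subset B$ and every $\varepsilon>0$ there is a linear operator $T:B\to B$ of finite rank with norm at most $1$ such that $\|Tx-x\|_B\le\varepsilon$ for every $x\in K$. *)

theory Defs
  imports "HOL-Complex_Analysis.Complex_Analysis"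
begin

section \<open>The closed strip and its space of bounded continuous functions\<close>

definition Sigma_strip :: "complex set" where
  "Sigma_strip = {z. 0 \<le> Im z \<and> Im z \<le> pi}"

text \<open>The strip is made a type, so that the library's space of bounded continuous functions,
  with its sup-norm, yields \<open>C\<^sub>b(\<Sigma>)\<close> as the type \<open>strip \<Rightarrow>\<^sub>C complex\<close>.
  The value of \<open>to_strip\<close> outside \<^const>\<open>Sigma_strip\<close> is unspecified and never used.\<close>

typedef strip = Sigma_strip
  morphisms of_strip to_strip
  by (auto simp: Sigma_strip_def intro!: exI[of _ 0])

instantiation strip :: metric_space
begin

definition dist_strip :: "strip \<Rightarrow> strip \<Rightarrow> real" where
  "dist_strip z w = dist (of_strip z) (of_strip w)"

definition uniformity_strip :: "(strip \<times> strip) filter" where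
  "uniformity_strip = (INF e\<in>{0<..}. principal {(x, y). dist x y < e})"

definition open_strip :: "strip set \<Rightarrow> bool" where
  "open_strip U = (\<forall>x\<in>U. \<forall>\<^sub>F (x', y) in uniformity. x' = x \<longrightarrow> y \<in> U)"

instance
  by standard (auto simp: dist_strip_def uniformity_strip_def open_strip_def of_strip_inject
      intro: dist_triangle2)

end

lemma of_strip_add_real: "of_strip z + of_real x \<in> Sigma_strip"
  using of_strip[of z] by (simp add: Sigma_strip_def)

lemma continuous_on_of_strip [continuous_intros]: "continuous_on A of_strip"
  unfolding continuous_on_iff dist_strip_def by blast

lemma continuous_on_to_strip: "continuous_on Sigma_strip to_strip"
  unfolding continuous_on_iff by (auto simp: dist_strip_def to_strip_inverse)

section \<open>Complex scalars and horizontal shifts\<close>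

definition scaleC_bcontfun :: "complex \<Rightarrow> (strip \<Rightarrow>\<^sub>C complex) \<Rightarrow> (strip \<Rightarrow>\<^sub>C complex)"
    (infixr "*\<^sub>C" 75) where
  "c *\<^sub>C f = Bcontfun (\<lambda>z. c * apply_bcontfun f z)"

definition shift :: "real \<Rightarrow> (strip \<Rightarrow>\<^sub>C complex) \<Rightarrow> (strip \<Rightarrow>\<^sub>C complex)" where
  "shift x f = Bcontfun (\<lambda>z. apply_bcontfun f (to_strip (of_strip z + of_real x)))"

lemma apply_scaleC_bcontfun [simp]: "apply_bcontfun (c *\<^sub>C f) z = c * apply_bcontfun f z"
proof -
  have "(\<lambda>z. c * apply_bcontfun f z) \<in> bcontfun"
  proof (rule bcontfun_normI)
    show "continuous_on UNIV (\<lambda>z. c * apply_bcontfun f z)"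
      by (intro continuous_intros continuous_on_apply_bcontfun)
    show "norm (c * apply_bcontfun f z) \<le> norm c * norm f" for z
      by (simp add: norm_mult mult_left_mono norm_bounded)
  qed
  then show ?thesis
    by (simp add: scaleC_bcontfun_def Bcontfun_inverse)
qed

lemma apply_shift [simp]:
  "apply_bcontfun (shift x f) z = apply_bcontfun f (to_strip (of_strip z + of_real x))"
proof -
  have "(\<lambda>z. apply_bcontfun f (to_strip (of_strip z + of_real x))) \<in> bcontfun"
  proof (rule bcontfun_normI)
    have "continuous_on UNIV (\<lambda>z. to_strip (of_strip z + of_real x))"
      by (rule continuous_on_compose2[OF continuous_on_to_strip])
         (auto intro!: continuous_intros of_strip_add_real)
    then show "continuous_on UNIV (\<lambda>z. apply_bcontfun f (to_strip (of_strip z + of_real x)))"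
      by (rule continuous_on_compose2[OF continuous_on_apply_bcontfun]) auto
    show "norm (apply_bcontfun f (to_strip (of_strip z + of_real x))) \<le> norm f" for z
      by (rule norm_bounded)
  qed
  then show ?thesis
    by (simp add: shift_def Bcontfun_inverse)
qed

interpretation scaleC_bcontfun: vector_space scaleC_bcontfun
  by standard (auto intro!: bcontfun_eqI simp: algebra_simps)

lemma norm_scaleC_bcontfun: "norm (c *\<^sub>C f) = cmod c * norm f"
proof -
  have le: "norm (c *\<^sub>C f) \<le> cmod c * norm f" for c f
    by (rule norm_bound) (simp add: norm_mult mult_left_mono norm_bounded)
  show ?thesis
  proof (cases "c = 0")
    case False
    have "norm f = norm (inverse c *\<^sub>C (c *\<^sub>C f))"
      using False by simp
    also have "\<dots> \<le> norm (c *\<^sub>C f) / cmod c"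
      using le[of "inverse c" "c *\<^sub>C f"] by (simp add: norm_inverse divide_inverse mult.commute)
    finally have "cmod c * norm f \<le> norm (c *\<^sub>C f)"
      using False by (simp add: pos_le_divide_eq mult.commute)
    with le[of c f] show ?thesis by simp
  qed simp
qed

section \<open>The space \<open>APH(\<Sigma>)\<close>\<close>

definition APH :: "(strip \<Rightarrow>\<^sub>C complex) set" where
  "APH = {f. (\<lambda>z. apply_bcontfun f (to_strip z)) holomorphic_on interior Sigma_strip \<and>
             compact (closure (range (\<lambda>x. shift x f)))}"

lemma compact_closure_iff_totally_bounded:
  fixes S :: "'a::complete_space set"
  shows "compact (closure S) \<longleftrightarrow> (\<forall>e>0. \<exists>k. finite k \<and> S \<subseteq> (\<Union>x\<in>k. ball x e))"
proof safe
  fix e :: real assume "compact (closure S)" "0 < e"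
  then show "\<exists>k. finite k \<and> S \<subseteq> (\<Union>x\<in>k. ball x e)"
    unfolding compact_eq_totally_bounded by (meson closure_subset order_trans)
next
  assume tb: "\<forall>e>0. \<exists>k. finite k \<and> S \<subseteq> (\<Union>x\<in>k. ball x e)"
  have "\<exists>k. finite k \<and> closure S \<subseteq> (\<Union>x\<in>k. ball x e)" if "0 < e" for e
  proof -
    obtain k where k: "finite k" "S \<subseteq> (\<Union>x\<in>k. ball x (e/2))"
      using tb \<open>0 < e\<close> half_gt_zero by blast
    have "closure S \<subseteq> (\<Union>x\<in>k. cball x (e/2))"
      using k by (intro closure_minimal closed_UN) (auto, force)
    also have "\<dots> \<subseteq> (\<Union>x\<in>k. ball x e)"
      using \<open>0 < e\<close> by auto
    finally show ?thesis using k by blast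
  qed
  then show "compact (closure S)"
    by (auto simp: compact_eq_totally_bounded complete_eq_closed)
qed

lemma compact_closure_subset:
  fixes S :: "'a::metric_space set"
  assumes "compact C" "S \<subseteq> C"
  shows "compact (closure S)"
proof -
  have "closure S \<subseteq> C"
    using assms by (simp add: closure_minimal compact_imp_closed)
  then show ?thesis
    using assms(1) by (metis closed_closure compact_Int_closed inf.absorb2)
qed

lemma shift_add: "shift x (f + g) = shift x f + shift x g"
  by (rule bcontfun_eqI) simp

lemma shift_scaleC: "shift x (c *\<^sub>C f) = c *\<^sub>C shift x f"
  by (rule bcontfun_eqI) simp

lemma dist_shift_le: "dist (shift x f) (shift x g) \<le> dist f g"
  by (rule dist_bound) (simp add: dist_bounded)

lemma subspace_APH: "scaleC_bcontfun.subspace APH"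
proof (rule scaleC_bcontfun.subspaceI)
  have "range (\<lambda>x. shift x 0) = {0}"
    by (auto intro!: bcontfun_eqI)
  then show "0 \<in> APH"
    by (simp add: APH_def)
next
  fix f g assume f: "f \<in> APH" and g: "g \<in> APH"
  let ?F = "closure (range (\<lambda>x. shift x f))" and ?G = "closure (range (\<lambda>x. shift x g))"
  have "compact {a + b |a b. a \<in> ?F \<and> b \<in> ?G}"
    using f g by (intro compact_sums) (auto simp: APH_def)
  moreover have "range (\<lambda>x. shift x (f + g)) \<subseteq> {a + b |a b. a \<in> ?F \<and> b \<in> ?G}"
  proof (intro image_subsetI)
    fix x
    have "shift x f \<in> ?F" "shift x g \<in> ?G"
      by (auto intro: subsetD[OF closure_subset])
    then show "shift x (f + g) \<in> {a + b |a b. a \<in> ?F \<and> b \<in> ?G}"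
      unfolding shift_add by blast
  qed
  ultimately have "compact (closure (range (\<lambda>x. shift x (f + g))))"
    by (rule compact_closure_subset)
  then show "f + g \<in> APH"
    using f g by (auto simp: APH_def intro!: holomorphic_intros)
next
  fix c f assume f: "f \<in> APH"
  let ?F = "closure (range (\<lambda>x. shift x f))"
  have "continuous_on ?F (\<lambda>f. c *\<^sub>C f)"
  proof (rule bounded_linear.continuous_on[OF _ continuous_on_id])
    show "bounded_linear (\<lambda>f. c *\<^sub>C f)"
      by (rule bounded_linear_intro[where K = "cmod c"])
         (auto intro!: bcontfun_eqI simp: norm_scaleC_bcontfun algebra_simps)
  qed
  then have "compact ((\<lambda>f. c *\<^sub>C f) ` ?F)"
    using f by (intro compact_continuous_image) (auto simp: APH_def)
  moreover have "range (\<lambda>x. shift x (c *\<^sub>C f)) \<subseteq> (\<lambda>f. c *\<^sub>C f) ` ?F"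
  proof (intro image_subsetI)
    fix x
    have "shift x f \<in> ?F"
      by (auto intro: subsetD[OF closure_subset])
    then show "shift x (c *\<^sub>C f) \<in> (\<lambda>f. c *\<^sub>C f) ` ?F"
      unfolding shift_scaleC by blast
  qed
  ultimately have "compact (closure (range (\<lambda>x. shift x (c *\<^sub>C f))))"
    by (rule compact_closure_subset)
  then show "c *\<^sub>C f \<in> APH"
    using f by (auto simp: APH_def intro!: holomorphic_intros)
qed

lemma closed_APH: "closed APH"
  unfolding closed_sequential_limits
proof safe
  fix f l assume f: "\<forall>n. f n \<in> APH" and lim: "f \<longlonglongrightarrow> l"
  have "(\<lambda>z. apply_bcontfun l (to_strip z)) holomorphic_on interior Sigma_strip"
  proof (rule holomorphic_uniform_sequence)
    show "(\<lambda>z. apply_bcontfun (f n) (to_strip z)) holomorphic_on interior Sigma_strip" for n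
      using f by (simp add: APH_def)
    have "uniform_limit UNIV (\<lambda>n z. apply_bcontfun (f n) (to_strip z))
            (\<lambda>z. apply_bcontfun l (to_strip z)) sequentially"
      by (rule uniform_limit_compose'[OF tendsto_bcontfun_uniform_limit[OF lim]]) auto
    then show "\<exists>d>0. cball x d \<subseteq> interior Sigma_strip \<and>
        uniform_limit (cball x d) (\<lambda>n z. apply_bcontfun (f n) (to_strip z))
          (\<lambda>z. apply_bcontfun l (to_strip z)) sequentially" if "x \<in> interior Sigma_strip" for x
      using that by (meson open_interior open_contains_cball uniform_limit_on_subset subset_UNIV)
  qed simp
  moreover have "compact (closure (range (\<lambda>x. shift x l)))"
    unfolding compact_closure_iff_totally_bounded
  proof (intro allI impI)
    fix e :: real assume "0 < e"
    then obtain n where n: "dist (f n) l < e/2"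
      using lim by (metis eventually_sequentially half_gt_zero order_refl tendstoD)
    obtain k where k: "finite k" "range (\<lambda>x. shift x (f n)) \<subseteq> (\<Union>x\<in>k. ball x (e/2))"
    proof -
      have "compact (closure (range (\<lambda>x. shift x (f n))))"
        using f by (simp add: APH_def)
      then show ?thesis
        using \<open>0 < e\<close> that unfolding compact_closure_iff_totally_bounded
        by (meson half_gt_zero)
    qed
    have "shift x l \<in> (\<Union>x\<in>k. ball x e)" for x
    proof -
      obtain a where a: "a \<in> k" "dist a (shift x (f n)) < e/2"
        using subsetD[OF k(2) rangeI[of _ x]] by auto
      have "dist a (shift x l) < e"
        using dist_triangle[of a "shift x l" "shift x (f n)"] dist_shift_le[of x "f n" l] a n
        by linarith
      with a show ?thesis by auto
    qed
    with k show "\<exists>k. finite k \<and> range (\<lambda>x. shift x l) \<subseteq> (\<Union>x\<in>k. ball x e)"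
      by blast
  qed
  ultimately show "l \<in> APH"
    by (simp add: APH_def)
qed

section \<open>The metric approximation property\<close>

text \<open>The complex Banach space is a closed complex subspace \<open>B\<close> of a normed type \<open>'a\<close> whose
  complex scalar multiplication is \<open>s\<close>. The operator \<open>T\<close> is only meaningful on \<open>B\<close>; the
  conjuncts make it a complex-linear map from \<open>B\<close> to \<open>B\<close> of operator norm at most \<open>1\<close>, whose rank is finite in the sense that its range lies in the complex span of
  a finite set.\<close>

definition metric_approximation_property ::
    "(complex \<Rightarrow> 'a::real_normed_vector \<Rightarrow> 'a) \<Rightarrow> 'a set \<Rightarrow> bool" where
  "metric_approximation_property s B \<longleftrightarrow>
    (\<forall>K \<epsilon>. compact K \<and> K \<subseteq> B \<and> 0 < \<epsilon> \<longrightarrow>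
      (\<exists>T. T ` B \<subseteq> B \<and>
           (\<forall>x\<in>B. \<forall>y\<in>B. T (x + y) = T x + T y) \<and>
           (\<forall>c. \<forall>x\<in>B. T (s c x) = s c (T x)) \<and>
           (\<exists>F. finite F \<and> T ` B \<subseteq> module.span s F) \<and>
           (\<forall>x\<in>B. norm (T x) \<le> norm x) \<and>
           (\<forall>x\<in>K. norm (T x - x) \<le> \<epsilon>)))"

end

theory Submission
  imports Defs "HOL-Probability.Distributions"
begin

text \<open>No Fourier expansion is needed. Choose a finite net \<open>F\<close> of the compact set and put
  \<open>d s = (\<Sum>f\<in>F. \<parallel>S\<^sub>s f - f\<parallel>)\<close>. Smoothing \<open>max 0 (e - d s)\<close> by a narrow Gaussian gives a kernel \<open>\<psi>\<close>
  that is entire, almost periodic, nonnegative on the line and concentrated on almost periods of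
  \<open>F\<close>. The operator \<open>W f z = 1/L \<integral>\<^sub>0\<^sup>L f(t) \<psi>(t - z) dt\<close> is the one to approximate by finite rank: since
  \<open>f\<close> and \<open>\<psi>\<close> are holomorphic, moving the contour from height \<open>0\<close> to height \<open>Im z\<close> costs only
  \<open>O(1/L)\<close> and turns \<open>W f z\<close> into an average of \<open>f(z + s)\<close> with the positive weight \<open>\<psi>(s)\<close>,
  \<open>s = t - Re z\<close>. The total weight is nearly independent of \<open>z\<close> by almost periodicity, so after
  normalisation \<open>W\<close> is almost a contraction and almost fixes \<open>F\<close>. Finally, a Riemann sum in
  \<open>t\<close> replaces \<open>W\<close> by an operator with values in the span of finitely many functions
  \<open>z \<mapsto> \<psi>(t - z)\<close>, which lie in \<open>APH\<close>.\<close>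

section \<open>Orbits under shifts\<close>

lemma shift_0 [simp]: "shift 0 f = f"
  by (rule bcontfun_eqI) (simp add: of_strip_inverse)

lemma shift_shift [simp]: "shift x (shift y f) = shift (x + y) f"
  by (rule bcontfun_eqI) (simp add: to_strip_inverse[OF of_strip_add_real] add.assoc)

text \<open>Every shift has an inverse shift, so the contraction estimate applied in both directions
  is an equality.\<close>

lemma dist_shift [simp]: "dist (shift x f) (shift x g) = dist f g"
  using dist_shift_le[of x f g] dist_shift_le[of "- x" "shift x f" "shift x g"] by simp

text \<open>The centres of a net of the orbit need not lie on the orbit. Replacing each by a nearby
  orbit point doubles the radius, and the net can then be indexed by real numbers.\<close>

lemma totally_bounded_orbit:
  assumes "f \<in> APH" "0 < e"
  obtains A where "finite A" "\<And>t. \<exists>a\<in>A. dist (shift t f) (shift a f) < e"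
proof -
  have "compact (closure (range (\<lambda>x. shift x f)))"
    using assms by (simp add: APH_def)
  then obtain k where k: "finite k" "range (\<lambda>x. shift x f) \<subseteq> (\<Union>x\<in>k. ball x (e/2))"
    using \<open>0 < e\<close> unfolding compact_closure_iff_totally_bounded by (meson half_gt_zero)
  define r where "r g = (SOME a. dist g (shift a f) < e/2)" for g
  show ?thesis
  proof
    show "finite (r ` k)" using k by simp
    fix t
    obtain g where g: "g \<in> k" "dist g (shift t f) < e/2"
      using subsetD[OF k(2) rangeI[of _ t]] by auto
    have "dist g (shift (r g) f) < e/2"
      unfolding r_def by (rule someI) (rule g)
    with g have "dist (shift t f) (shift (r g) f) < e"
      using dist_triangle_half_r by blast
    with g show "\<exists>a\<in>r ` k. dist (shift t f) (shift a f) < e" by blast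
  qed
qed

text \<open>One set of translations must serve all functions at once. The nets for \<open>F\<close>
  and for \<open>g\<close> classify each \<open>t\<close> by a pair \<open>(a, b)\<close>, and one
  representative per pair that occurs suffices.\<close>

lemma totally_bounded_orbits:
  assumes "finite F" "F \<subseteq> APH" "0 < e"
  shows "\<exists>A. finite A \<and> (\<forall>t. \<exists>a\<in>A. \<forall>f\<in>F. dist (shift t f) (shift a f) < e)"
  using assms
proof (induction F arbitrary: e rule: finite_induct)
  case empty
  show ?case by (intro exI[of _ "{0}"]) auto
next
  case (insert g F)
  obtain A where A: "finite A" "\<And>t. \<exists>a\<in>A. \<forall>f\<in>F. dist (shift t f) (shift a f) < e/2"
    using insert.IH[of "e/2"] insert.prems by auto
  obtain B where B: "finite B" "\<And>t. \<exists>a\<in>B. dist (shift t g) (shift a g) < e/2"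
    using totally_bounded_orbit[of g "e/2"] insert.prems by auto
  define P where "P t a b \<longleftrightarrow> (\<forall>f\<in>F. dist (shift t f) (shift a f) < e/2) \<and>
    dist (shift t g) (shift b g) < e/2" for t a b
  define r where "r = (\<lambda>(a, b). SOME t. P t a b)"
  show ?case
  proof (intro exI[of _ "r ` (A \<times> B)"] conjI allI)
    show "finite (r ` (A \<times> B))" using A B by simp
    fix t
    obtain a b where ab: "a \<in> A" "b \<in> B" "P t a b"
      using A(2)[of t] B(2)[of t] unfolding P_def by blast
    then have "P (r (a, b)) a b"
      unfolding r_def by (auto intro: someI)
    then have "\<forall>f\<in>insert g F. dist (shift t f) (shift (r (a, b)) f) < e"
      using ab(3) unfolding P_def by (blast intro: dist_triangle_half_l)
    then show "\<exists>a\<in>r ` (A \<times> B). \<forall>f\<in>insert g F. dist (shift t f) (shift a f) < e"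
      using ab by blast
  qed
qed

text \<open>Almost periodicity reduces uniform continuity along horizontal lines to a compact
  rectangle: up to \<open>e/4\<close>, abscissa \<open>x\<close> may be replaced by some
  \<open>a\<close> from a finite set, both before and after the displacement by
  \<open>u\<close>.\<close>

lemma shift_tendsto:
  assumes "f \<in> APH"
  shows "((\<lambda>u. norm (shift u f - f)) \<longlongrightarrow> 0) (at 0)"
proof (rule tendstoI)
  fix e :: real assume "0 < e"
  define h where "h z = apply_bcontfun f (to_strip z)" for z
  obtain A where A: "finite A" "\<And>t. \<exists>a\<in>A. dist (shift t f) (shift a f) < e/4"
    using totally_bounded_orbit[OF assms, of "e/4"] \<open>0 < e\<close> by auto
  \<comment> \<open>The extra 1 keeps \<open>a + u\<close> inside the rectangle for displacements
    with absolute value below 1.\<close>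
  define R where "R = Max (insert 0 ((\<lambda>a. \<bar>a\<bar>) ` A)) + 1"
  have R: "\<bar>a\<bar> + 1 \<le> R" if "a \<in> A" for a
    unfolding R_def using that A(1) by (auto intro!: Max_ge)
  have "compact (cbox (Complex (-R) 0) (Complex R pi))"
    by simp
  moreover have "continuous_on (cbox (Complex (-R) 0) (Complex R pi)) h"
    unfolding h_def
    by (rule continuous_on_compose2[OF continuous_on_apply_bcontfun
          continuous_on_subset[OF continuous_on_to_strip]])
       (auto simp: Sigma_strip_def in_cbox_complex_iff)
  ultimately have "uniformly_continuous_on (cbox (Complex (-R) 0) (Complex R pi)) h"
    by (rule compact_uniformly_continuous[rotated])
  then obtain d where d: "0 < d" "\<And>x y. x \<in> cbox (Complex (-R) 0) (Complex R pi) \<Longrightarrow>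
      y \<in> cbox (Complex (-R) 0) (Complex R pi) \<Longrightarrow> dist y x < d \<Longrightarrow> dist (h y) (h x) < e/4"
    using \<open>0 < e\<close> unfolding uniformly_continuous_on_def by (metis zero_less_divide_iff zero_less_numeral)
  have cx: "Complex v b + of_real t = Complex (t + v) b" for v b t
    by (simp add: complex_eq_iff)
  have "norm (shift u f - f) < e" if u: "\<bar>u\<bar> < min d 1" for u
  proof -
    have "dist (shift u f) f \<le> 3 * e / 4"
    proof (rule dist_bound)
      fix z
      define x y where "x = Re (of_strip z)" and "y = Im (of_strip z)"
      have y: "0 \<le> y" "y \<le> pi"
        using of_strip[of z] by (auto simp: y_def Sigma_strip_def)
      have z: "of_strip z = Complex x y" by (simp add: x_def y_def)
      \<comment> \<open>The point of the imaginary axis at the height of \<open>z\<close>: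
        evaluating \<open>shift x f\<close> and \<open>shift a f\<close> there compares
        \<open>f\<close> at abscissas \<open>x\<close> and \<open>a\<close>.\<close>
      define w where "w = to_strip (Complex 0 y)"
      have w: "of_strip w = Complex 0 y"
        unfolding w_def using y by (subst to_strip_inverse) (auto simp: Sigma_strip_def)
      obtain a where a: "a \<in> A" "dist (shift x f) (shift a f) < e/4"
        using A(2) by blast
      have *: "dist (apply_bcontfun (shift x f) v) (apply_bcontfun (shift a f) v) < e/4" for v
        using dist_bounded[of "shift x f" v "shift a f"] a(2) by linarith
      have w': "of_strip (to_strip (of_strip w + of_real u)) = Complex u y"
        by (subst to_strip_inverse[OF of_strip_add_real]) (simp add: w complex_eq_iff)
      have 1: "dist (h (Complex x y)) (h (Complex a y)) < e/4"
        using *[of w] by (simp add: w h_def cx)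
      have 2: "dist (h (Complex (x + u) y)) (h (Complex (a + u) y)) < e/4"
        using *[of "to_strip (of_strip w + of_real u)"]
        by (simp only: apply_shift w') (simp add: h_def cx)
      have 3: "dist (h (Complex (a + u) y)) (h (Complex a y)) < e/4"
      proof (rule d(2))
        show "Complex a y \<in> cbox (Complex (-R) 0) (Complex R pi)"
          "Complex (a + u) y \<in> cbox (Complex (-R) 0) (Complex R pi)"
          using R[OF a(1)] y u by (auto simp: in_cbox_complex_iff)
        have "Complex (a + u) y - Complex a y = of_real u"
          by (simp add: complex_eq_iff)
        then show "dist (Complex (a + u) y) (Complex a y) < d"
          using u by (simp add: dist_norm)
      qed
      have "dist (h (Complex (x + u) y)) (h (Complex x y)) \<le> 3 * e / 4"
        using 1 2 3 dist_triangle[of "h (Complex (x + u) y)" "h (Complex x y)" "h (Complex (a + u) y)"]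
          dist_triangle[of "h (Complex (a + u) y)" "h (Complex x y)" "h (Complex a y)"]
          dist_commute[of "h (Complex x y)" "h (Complex a y)"] by linarith
      moreover have "to_strip (Complex x y) = z"
        unfolding z[symmetric] by (rule of_strip_inverse)
      ultimately show "dist (apply_bcontfun (shift u f) z) (apply_bcontfun f z) \<le> 3 * e / 4"
        by (simp add: h_def z cx add.commute[of u x])
    qed
    then show ?thesis using \<open>0 < e\<close> by (simp add: dist_norm)
  qed
  then show "\<forall>\<^sub>F u in at 0. dist (norm (shift u f - f)) 0 < e"
    unfolding eventually_at using d(1) by (intro exI[of _ "min d 1"]) auto
qed

section \<open>Almost periods\<close>

text \<open>The model is \<open>d s = (\<Sum>f\<in>F. \<parallel>S\<^sub>s f - f\<parallel>)\<close> for a finite set \<open>F\<close>: small values of \<open>d\<close> mark the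
  common almost periods of \<open>F\<close>.\<close>

locale almost_period_length =
  fixes d :: "real \<Rightarrow> real"
  assumes zero [simp]: "d 0 = 0"
    and minus [simp]: "d (- s) = d s"
    and subadd: "d (s + t) \<le> d s + d t"
    and tendsto_zero: "(d \<longlongrightarrow> 0) (at 0)"
    and net: "0 < e \<Longrightarrow> \<exists>A. finite A \<and> (\<forall>t. \<exists>a\<in>A. d (t - a) < e)"
begin

lemma nonneg [simp]: "0 \<le> d s"
  using subadd[of s "- s"] by simp

lemma diff_le: "\<bar>d s - d t\<bar> \<le> d (s - t)"
proof -
  have "d s \<le> d (s - t) + d t" "d t \<le> d (t - s) + d s"
    using subadd[of "s - t" t] subadd[of "t - s" s] by simp_all
  moreover have "d (t - s) = d (s - t)"
    using minus[of "s - t"] by simp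
  ultimately show ?thesis by linarith
qed

lemma continuous: "continuous_on UNIV d"
proof -
  have "(d \<longlongrightarrow> d x) (at x)" for x
  proof (rule Lim_transform2)
    show "((\<lambda>y. d x) \<longlongrightarrow> d x) (at x)" by simp
    have "((\<lambda>y. d (y - x)) \<longlongrightarrow> 0) (at x)"
      using tendsto_zero by (simp add: LIM_offset_zero_iff[of x] add.commute)
    then show "((\<lambda>y. d x - d y) \<longlongrightarrow> 0) (at x)"
      by (rule Lim_null_comparison[rotated])
         (use diff_le in \<open>auto simp: abs_minus_commute intro!: always_eventually\<close>)
  qed
  then show ?thesis by (simp add: continuous_on)
qed

text \<open>By subadditivity, \<open>d s\<close> exceeds the value at a nearby net point by less
  than 1, and the net is finite.\<close>

lemma bounded: "\<exists>D>0. \<forall>s. d s \<le> D"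
proof -
  obtain A where A: "finite A" "\<And>t. \<exists>a\<in>A. d (t - a) < 1"
    using net[of 1] by auto
  have "d s \<le> 1 + (\<Sum>a\<in>A. d a)" for s
  proof -
    obtain a where a: "a \<in> A" "d (s - a) < 1" using A(2) by blast
    have "d s \<le> d (s - a) + d a" using subadd[of "s - a" a] by simp
    moreover have "d a \<le> (\<Sum>a\<in>A. d a)"
      using A(1) a(1) by (intro member_le_sum) auto
    ultimately show ?thesis using a by linarith
  qed
  moreover have "0 < 1 + (\<Sum>a\<in>A. d a)"
    by (intro add_pos_nonneg sum_nonneg) auto
  ultimately show ?thesis by blast
qed

end

text \<open>Shifts are isometries, so \<open>norm (shift (t - a) f - f)\<close> is the distance of
  two orbit points. The net condition is therefore simultaneous total boundedness of the
  orbits.\<close>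

lemma almost_period_length_APH:
  assumes F: "finite F" "F \<subseteq> APH"
  shows "almost_period_length (\<lambda>s. \<Sum>f\<in>F. norm (shift s f - f))"
proof
  have *: "norm (shift (t - a) f - f) = dist (shift t f) (shift a f)" for t a f
    using dist_shift[of "a" "shift (t - a) f" f] by (simp add: dist_norm)
  show "(\<Sum>f\<in>F. norm (shift 0 f - f)) = 0" by simp
  show "(\<Sum>f\<in>F. norm (shift (- s) f - f)) = (\<Sum>f\<in>F. norm (shift s f - f))" for s
    using *[of 0 s] *[of s 0] by (simp add: dist_commute)
  show "(\<Sum>f\<in>F. norm (shift (s + t) f - f)) \<le>
      (\<Sum>f\<in>F. norm (shift s f - f)) + (\<Sum>f\<in>F. norm (shift t f - f))" for s t
    unfolding sum.distrib[symmetric]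
  proof (rule sum_mono)
    fix f
    have "dist (shift (s + t) f) f \<le> dist (shift (s + t) f) (shift s f) + dist (shift s f) f"
      by (rule dist_triangle)
    also have "dist (shift (s + t) f) (shift s f) = norm (shift t f - f)"
      using *[of "s + t" s f] by simp
    finally show "norm (shift (s + t) f - f) \<le> norm (shift s f - f) + norm (shift t f - f)"
      by (simp add: dist_norm)
  qed
  show "((\<lambda>s. \<Sum>f\<in>F. norm (shift s f - f)) \<longlongrightarrow> 0) (at 0)"
    by (rule tendsto_null_sum) (use F shift_tendsto in auto)
  fix e :: real assume "0 < e"
  \<comment> \<open>The summand 1 covers empty \<open>F\<close> and makes the final inequality
    strict.\<close>
  then have e': "0 < e / (card F + 1)" by simp
  obtain A where A: "finite A"
    "\<And>t. \<exists>a\<in>A. \<forall>f\<in>F. dist (shift t f) (shift a f) < e / (card F + 1)"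
    using totally_bounded_orbits[OF F e'] by auto
  have "\<exists>a\<in>A. (\<Sum>f\<in>F. norm (shift (t - a) f - f)) < e" for t
  proof -
    obtain a where a: "a \<in> A" "\<forall>f\<in>F. dist (shift t f) (shift a f) < e / (card F + 1)"
      using A(2) by blast
    have "(\<Sum>f\<in>F. norm (shift (t - a) f - f)) \<le> (\<Sum>f\<in>F. e / (card F + 1))"
      unfolding * using a(2) by (intro sum_mono) (auto simp: less_imp_le)
    also have "\<dots> < e" using \<open>0 < e\<close> by (simp add: field_simps)
    finally show ?thesis using a(1) by blast
  qed
  with A(1) show "\<exists>A. finite A \<and> (\<forall>t. \<exists>a\<in>A. (\<Sum>f\<in>F. norm (shift (t - a) f - f)) < e)"
    by blast
qed

section \<open>Gaussian smoothing\<close>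

text \<open>The entire extension of the centred normal density with standard deviation
  \<sigma>.\<close>

definition gaussian :: "real \<Rightarrow> complex \<Rightarrow> complex" where
  "gaussian \<sigma> w = exp (- w\<^sup>2 / of_real (2 * \<sigma>\<^sup>2)) / of_real (sqrt (2 * pi * \<sigma>\<^sup>2))"

lemma gaussian_of_real: "gaussian \<sigma> (of_real x) = of_real (normal_density 0 \<sigma> x)"
  by (simp add: gaussian_def normal_density_def exp_of_real[symmetric] del: exp_of_real)

text \<open>Leaving the real axis costs a factor that depends only on the height; what remains is a
  probability density in \<open>s\<close>.\<close>

lemma norm_gaussian:
  "norm (gaussian \<sigma> (w - of_real s)) = exp ((Im w)\<^sup>2 / (2 * \<sigma>\<^sup>2)) * normal_density (Re w) \<sigma> s"
proof -
  have "Re (- (w - of_real s)\<^sup>2 / of_real (2 * \<sigma>\<^sup>2)) = (Im w)\<^sup>2 / (2 * \<sigma>\<^sup>2) + - (s - Re w)\<^sup>2 / (2 * \<sigma>\<^sup>2)"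
    unfolding Re_divide_of_real
    by (simp add: power2_eq_square diff_divide_distrib[symmetric] add_divide_distrib[symmetric])
       (simp add: algebra_simps)
  then have "norm (exp (- (w - of_real s)\<^sup>2 / of_real (2 * \<sigma>\<^sup>2)))
      = exp ((Im w)\<^sup>2 / (2 * \<sigma>\<^sup>2)) * exp (- (s - Re w)\<^sup>2 / (2 * \<sigma>\<^sup>2))"
    unfolding norm_exp_eq_Re by (simp only: exp_add)
  then show ?thesis
    by (simp add: gaussian_def normal_density_def norm_divide)
qed

lemma continuous_gaussian [continuous_intros]:
  "continuous_on A f \<Longrightarrow> continuous_on A (\<lambda>x. gaussian \<sigma> (f x))"
  unfolding gaussian_def divide_inverse by (intro continuous_intros)

text \<open>Convolution with the Gaussian, evaluated at a complex point; only \<phi> is confined to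
  the real line.\<close>

definition gaussian_smoothing :: "real \<Rightarrow> (real \<Rightarrow> real) \<Rightarrow> complex \<Rightarrow> complex" where
  "gaussian_smoothing \<sigma> \<phi> w = (LINT s|lborel. of_real (\<phi> s) * gaussian \<sigma> (w - of_real s))"

locale smoothing =
  fixes \<sigma> B :: real and \<phi> :: "real \<Rightarrow> real"
  assumes sigma: "0 < \<sigma>" and cont: "continuous_on UNIV \<phi>" and bound: "\<And>s. \<bar>\<phi> s\<bar> \<le> B"
begin

lemma measurable_integrand [measurable]:
  "(\<lambda>s. of_real (\<phi> s) * gaussian \<sigma> (w - of_real s)) \<in> borel_measurable borel"
  by (intro borel_measurable_continuous_onI continuous_intros cont)

lemma norm_integrand_le:
  "norm (of_real (\<phi> s) * gaussian \<sigma> (w - of_real s))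
    \<le> B * (exp ((Im w)\<^sup>2 / (2 * \<sigma>\<^sup>2)) * normal_density (Re w) \<sigma> s)"
  unfolding norm_mult norm_gaussian using bound[of s] by (intro mult_right_mono) auto

lemma integrable_integrand:
  "integrable lborel (\<lambda>s. of_real (\<phi> s) * gaussian \<sigma> (w - of_real s))"
proof (rule Bochner_Integration.integrable_bound)
  show "integrable lborel (\<lambda>s. B * (exp ((Im w)\<^sup>2 / (2 * \<sigma>\<^sup>2)) * normal_density (Re w) \<sigma> s))"
    using sigma by simp
qed (use norm_integrand_le in \<open>auto intro!: AE_I2 order_trans[OF _ abs_ge_self]\<close>)

lemma norm_le:
  "norm (gaussian_smoothing \<sigma> \<phi> w) \<le> B * exp ((Im w)\<^sup>2 / (2 * \<sigma>\<^sup>2))"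
proof -
  have "norm (gaussian_smoothing \<sigma> \<phi> w)
      \<le> (LINT s|lborel. B * (exp ((Im w)\<^sup>2 / (2 * \<sigma>\<^sup>2)) * normal_density (Re w) \<sigma> s))"
    unfolding gaussian_smoothing_def
    using sigma norm_integrand_le by (intro Bochner_Integration.integral_norm_bound_integral integrable_integrand) auto
  then show ?thesis using sigma by simp
qed

lemma integrable_real: "integrable lborel (\<lambda>s. \<phi> s * normal_density x \<sigma> s)"
proof (rule Bochner_Integration.integrable_bound)
  show "integrable lborel (\<lambda>s. B * normal_density x \<sigma> s)"
    using sigma by simp
  show "(\<lambda>s. \<phi> s * normal_density x \<sigma> s) \<in> borel_measurable lborel"
    using borel_measurable_continuous_onI[OF cont] by measurable
  show "AE s in lborel. norm (\<phi> s * normal_density x \<sigma> s) \<le> norm (B * normal_density x \<sigma> s)"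
    using bound by (intro AE_I2) (auto simp: abs_mult intro!: mult_right_mono order_trans[OF _ abs_ge_self])
qed

lemma smoothing_of_real:
  "gaussian_smoothing \<sigma> \<phi> (of_real x) = of_real (LINT s|lborel. \<phi> s * normal_density x \<sigma> s)"
proof -
  have "gaussian \<sigma> (of_real x - of_real s) = of_real (normal_density x \<sigma> s)" for s
    using gaussian_of_real[of \<sigma> "x - s"]
    by (simp add: normal_density_def power2_commute)
  then show ?thesis
    unfolding gaussian_smoothing_def by (simp flip: of_real_mult integral_complex_of_real)
qed

text \<open>Substitution moves a real translation from the complex argument to \<phi>, so almost
  periods of \<phi> become almost periods of the smoothing on every horizontal line.\<close>

lemma smoothing_add:
  "gaussian_smoothing \<sigma> \<phi> (w + of_real t) = gaussian_smoothing \<sigma> (\<lambda>s. \<phi> (s + t)) w"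
  unfolding gaussian_smoothing_def
  by (subst lborel_integral_real_affine[where c = 1 and t = t]) (simp_all add: add.commute)

lemma smoothing_diff:
  assumes "smoothing \<sigma> B' \<phi>'"
  shows "gaussian_smoothing \<sigma> (\<lambda>s. \<phi> s - \<phi>' s) w = gaussian_smoothing \<sigma> \<phi> w - gaussian_smoothing \<sigma> \<phi>' w"
  unfolding gaussian_smoothing_def
  by (subst Bochner_Integration.integral_diff[symmetric])
     (auto intro: integrable_integrand smoothing.integrable_integrand[OF assms] simp: left_diff_distrib)

text \<open>Widening the Gaussian by a factor \<open>sqrt 2\<close> dominates all centres in a
  bounded interval at once. This supplies one integrable majorant on a whole disc.\<close>

lemma normal_density_shift_le:
  fixes x s R :: real
  assumes "\<bar>x\<bar> \<le> R"
  shows "normal_density x \<sigma> s \<le> exp (R\<^sup>2 / (2 * \<sigma>\<^sup>2)) * sqrt 2 * normal_density 0 (sqrt 2 * \<sigma>) s"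
proof -
  \<comment> \<open>Expand \<open>(s - 2 * x)\<^sup>2 \<ge> 0\<close>, halve it, and use
    \<open>x\<^sup>2 \<le> R\<^sup>2\<close>.\<close>
  have "s\<^sup>2 / 2 - R\<^sup>2 \<le> (s - x)\<^sup>2"
  proof -
    have "x\<^sup>2 \<le> R\<^sup>2" using assms by (simp add: abs_le_square_iff[symmetric])
    moreover have "0 \<le> (s - 2 * x)\<^sup>2" by simp
    ultimately show ?thesis by (simp add: power2_eq_square algebra_simps)
  qed
  then have "- (s - x)\<^sup>2 / (2 * \<sigma>\<^sup>2) \<le> (R\<^sup>2 - s\<^sup>2 / 2) / (2 * \<sigma>\<^sup>2)"
    by (intro divide_right_mono) auto
  also have "\<dots> = R\<^sup>2 / (2 * \<sigma>\<^sup>2) + - (s - 0)\<^sup>2 / (2 * (sqrt 2 * \<sigma>)\<^sup>2)"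
    by (simp add: power_mult_distrib diff_divide_distrib)
  finally have "exp (- (s - x)\<^sup>2 / (2 * \<sigma>\<^sup>2))
      \<le> exp (R\<^sup>2 / (2 * \<sigma>\<^sup>2)) * exp (- (s - 0)\<^sup>2 / (2 * (sqrt 2 * \<sigma>)\<^sup>2))"
    by (simp add: exp_add[symmetric])
  moreover have "sqrt (2 * pi * (sqrt 2 * \<sigma>)\<^sup>2) = sqrt 2 * sqrt (2 * pi * \<sigma>\<^sup>2)"
    by (simp add: power_mult_distrib real_sqrt_mult)
  ultimately show ?thesis
    using sigma unfolding normal_density_def by (simp add: divide_right_mono field_simps)
qed

text \<open>The integrals over \<open>[-n, n]\<close> are entire by differentiation under the
  integral sign. On each unit disc they converge uniformly, since the tails have an integrable
  majorant independent of \<open>w\<close>.\<close>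

lemma holomorphic: "gaussian_smoothing \<sigma> \<phi> holomorphic_on UNIV"
proof (rule holomorphic_uniform_sequence)
  let ?g = "\<lambda>w s. of_real (\<phi> s) * gaussian \<sigma> (w - of_real s)"
  let ?I = "\<lambda>n. {- real n..real n}"
  define G where "G n w = integral (cbox (- real n) (real n)) (?g w)" for n w
  show "open (UNIV :: complex set)" by simp
  show "G n holomorphic_on UNIV" for n
    unfolding G_def
  proof (rule leibniz_rule_holomorphic)
    show "((\<lambda>w. ?g w s) has_field_derivative
        ?g w s * (- (w - of_real s) / of_real (\<sigma>\<^sup>2))) (at w within UNIV)" for w s
      unfolding gaussian_def using sigma
      by (auto intro!: derivative_eq_intros simp: field_simps power2_eq_square)
    show "?g w integrable_on cbox (- real n) (real n)" for w
      by (intro integrable_continuous continuous_intros continuous_on_subset[OF cont]) auto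
    show "continuous_on (UNIV \<times> cbox (- real n) (real n))
        (\<lambda>(w, s). ?g w s * (- (w - of_real s) / of_real (\<sigma>\<^sup>2)))"
      unfolding split_beta divide_inverse
      by (intro continuous_intros continuous_on_compose2[OF cont]) auto
  qed simp
  fix x :: complex
  \<comment> \<open>A bound for the modulus on the closed unit disc around \<open>x\<close>.\<close>
  define R where "R = cmod x + 1"
  define K where "K = B * (exp (R\<^sup>2 / (2 * \<sigma>\<^sup>2)) * (exp (R\<^sup>2 / (2 * \<sigma>\<^sup>2)) * sqrt 2))"
  define h where "h s = K * normal_density 0 (sqrt 2 * \<sigma>) s" for s
  have B: "0 \<le> B" using bound[of 0] by linarith
  have h: "integrable lborel h" unfolding h_def using sigma by simp
  have h_nonneg: "0 \<le> h s" for s unfolding h_def K_def using B by simp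
  have le_h: "norm (?g w s) \<le> h s" if w: "w \<in> cball x 1" for w s
  proof -
    have nw: "norm w \<le> R"
      using w norm_triangle_ineq2[of w x] by (simp add: R_def dist_norm norm_minus_commute)
    have *: "\<bar>Re w\<bar> \<le> R" "(Im w)\<^sup>2 \<le> R\<^sup>2"
      using abs_Re_le_cmod[of w] abs_Im_le_cmod[of w] nw by (auto simp: abs_le_square_iff[symmetric])
    have "norm (?g w s) \<le> B * (exp ((Im w)\<^sup>2 / (2 * \<sigma>\<^sup>2)) * normal_density (Re w) \<sigma> s)"
      by (rule norm_integrand_le)
    also have "\<dots> \<le> B * (exp (R\<^sup>2 / (2 * \<sigma>\<^sup>2)) *
        (exp (R\<^sup>2 / (2 * \<sigma>\<^sup>2)) * sqrt 2 * normal_density 0 (sqrt 2 * \<sigma>) s))"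
      using * B by (intro mult_left_mono mult_mono normal_density_shift_le)
        (auto intro!: divide_right_mono)
    finally show ?thesis by (simp add: h_def K_def mult.assoc)
  qed
  have tail: "(\<lambda>n. LINT s|lborel. indicator (- ?I n) s * h s) \<longlonglongrightarrow> integral\<^sup>L lborel (\<lambda>s::real. 0::real)"
  proof (rule Bochner_Integration.integral_dominated_convergence[where w = h])
    show "AE s in lborel. (\<lambda>n. indicator (- ?I n) s * h s) \<longlonglongrightarrow> 0"
    proof (rule AE_I2, rule tendsto_eventually)
      fix s :: real
      obtain N where "\<bar>s\<bar> \<le> real N" using real_arch_simple by blast
      then have "s \<in> ?I n" if "n \<ge> N" for n
        using that by (auto simp: abs_le_iff)
      then show "\<forall>\<^sub>F n in sequentially. indicator (- ?I n) s * h s = 0"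
        by (intro eventually_sequentiallyI[of N]) auto
    qed
    show "AE s in lborel. norm (indicator (- ?I n) s * h s) \<le> h s" for n
      using h_nonneg by (intro AE_I2) (auto simp: indicator_def)
  qed (use h in auto)
  have diff: "dist (G n w) (gaussian_smoothing \<sigma> \<phi> w) \<le> (LINT s|lborel. indicator (- ?I n) s * h s)"
    if w: "w \<in> cball x 1" for n w
  proof -
    have int: "integrable lborel (\<lambda>s. indicator A s *\<^sub>R ?g w s)" if "A \<in> sets borel" for A
      using integrable_integrand[of w] that by (intro integrable_mult_indicator) auto
    have "G n w = (LINT s|lborel. indicator (?I n) s *\<^sub>R ?g w s)"
      using set_borel_integral_eq_integral(2)[of "?I n" "?g w"] int[of "?I n"]
      by (simp add: G_def set_lebesgue_integral_def set_integrable_def)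
    moreover have "gaussian_smoothing \<sigma> \<phi> w = (LINT s|lborel. indicator (?I n) s *\<^sub>R ?g w s +
        indicator (- ?I n) s *\<^sub>R ?g w s)"
      unfolding gaussian_smoothing_def by (intro Bochner_Integration.integral_cong) (auto simp: indicator_def)
    ultimately have "gaussian_smoothing \<sigma> \<phi> w - G n w = (LINT s|lborel. indicator (- ?I n) s *\<^sub>R ?g w s)"
      using int by (subst (asm) Bochner_Integration.integral_add) auto
    moreover have "norm (LINT s|lborel. indicator (- ?I n) s *\<^sub>R ?g w s)
        \<le> (LINT s|lborel. indicator (- ?I n) s * h s)"
    proof (rule Bochner_Integration.integral_norm_bound_integral)
      show "integrable lborel (\<lambda>s. indicator (- ?I n) s * h s)"
        using integrable_mult_indicator[OF _ h, of "- ?I n"] by simp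
      show "norm (indicator (- ?I n) s *\<^sub>R ?g w s) \<le> indicator (- ?I n) s * h s" for s
        using le_h[OF w, of s] by (auto simp: indicator_def)
    qed (use int in auto)
    ultimately show ?thesis by (metis dist_norm dist_commute)
  qed
  show "\<exists>r>0. cball x r \<subseteq> UNIV \<and> uniform_limit (cball x r) G (gaussian_smoothing \<sigma> \<phi>) sequentially"
  proof (intro exI[of _ 1] conjI uniform_limitI)
    fix e :: real assume "0 < e"
    then have "\<forall>\<^sub>F n in sequentially. (LINT s|lborel. indicator (- ?I n) s * h s) < e"
      using tail by (auto intro: order_tendstoD)
    then show "\<forall>\<^sub>F n in sequentially. \<forall>w\<in>cball x 1. dist (G n w) (gaussian_smoothing \<sigma> \<phi> w) < e"
      by eventually_elim (use diff in \<open>blast intro: le_less_trans\<close>)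
  qed auto
qed

end

section \<open>Kernels concentrated on almost periods\<close>

text \<open>A nonnegative kernel \<open>q\<close> on the line that charges mainly the \<open>e\<close>-almost periods and extends
  to an entire function \<open>\<psi>\<close> that is almost periodic on the strip \<open>\<bar>Im w\<bar> \<le> \<pi>\<close>. The assumption \<open>lower\<close>
  bounds the mean of \<open>q\<close> from below by about \<open>2c\<close>, which makes the error \<open>e * c\<close> in
  \<open>concentrated\<close> relatively small.\<close>

locale almost_period_kernel = almost_period_length d
  for d :: "real \<Rightarrow> real" +
  fixes e :: real and \<psi> :: "complex \<Rightarrow> complex" and q :: "real \<Rightarrow> real" and C M c :: real
    and A :: "real set"
  assumes holomorphic: "\<psi> holomorphic_on UNIV"
    and real: "\<psi> (of_real s) = of_real (q s)"
    and q_nonneg: "0 \<le> q s"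
    and bound: "\<bar>Im w\<bar> \<le> pi \<Longrightarrow> norm (\<psi> w) \<le> M"
    and lipschitz: "\<bar>Im w\<bar> \<le> pi \<Longrightarrow> norm (\<psi> (w + of_real t) - \<psi> w) \<le> C * d t"
    and concentrated: "d s * q s \<le> e * (q s + c)"
    and finite_A: "finite A" and A_nonempty: "A \<noteq> {}"
    and c_pos: "0 < c" and C_nonneg: "0 \<le> C"
    and lower: "2 * c * card A \<le> (\<Sum>a\<in>A. q (s - a))"

section \<open>Existence of the kernels\<close>

context almost_period_length
begin

text \<open>A Chebyshev-type argument: a constant plus a multiple of \<open>u\<^sup>2\<close>
  majorises \<open>d\<close>, and the Gaussian mean of this majorant is explicit.\<close>

lemma gaussian_mean_small:
  assumes "0 < c"
  obtains \<sigma> where "0 < \<sigma>" "\<And>x. integrable lborel (\<lambda>s. d (s - x) * normal_density x \<sigma> s)"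
    "\<And>x. (LINT s|lborel. d (s - x) * normal_density x \<sigma> s) \<le> c"
proof -
  obtain D where D: "0 < D" "\<And>s. d s \<le> D" using bounded by auto
  have "\<forall>\<^sub>F u in at 0. dist (d u) 0 < c / 2"
    using tendsto_zero assms by (intro tendstoD) auto
  then obtain r where r: "0 < r" "\<And>u. u \<noteq> 0 \<Longrightarrow> \<bar>u\<bar> < r \<Longrightarrow> d u < c / 2"
    unfolding eventually_at by (auto simp: dist_norm)
  \<comment> \<open>Chosen so that the quadratic part of the majorant has mean exactly
    \<open>c / 2\<close>.\<close>
  define \<sigma> where "\<sigma> = r * sqrt (c / (2 * D))"
  have \<sigma>: "0 < \<sigma>" "D / r\<^sup>2 * \<sigma>\<^sup>2 = c / 2"
    using D r assms by (auto simp: \<sigma>_def power_mult_distrib)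
  \<comment> \<open>Inside radius \<open>r\<close> the constant suffices; outside it the quadratic
    term alone exceeds \<open>D\<close>.\<close>
  have le: "d u \<le> c / 2 + D / r\<^sup>2 * u\<^sup>2" for u
  proof (cases "\<bar>u\<bar> < r")
    case True
    then have "d u \<le> c / 2" using r(2)[of u] assms by (cases "u = 0") auto
    moreover have "0 \<le> D / r\<^sup>2 * u\<^sup>2" using D by simp
    ultimately show ?thesis by linarith
  next
    case False
    then have "r\<^sup>2 \<le> u\<^sup>2" using r(1) by (simp add: abs_le_square_iff[symmetric])
    then have "D \<le> D / r\<^sup>2 * u\<^sup>2" using D r(1) by (simp add: field_simps)
    then show ?thesis using D(2)[of u] assms by linarith
  qed
  let ?g = "\<lambda>x s. (c / 2) * normal_density x \<sigma> s + D / r\<^sup>2 * (normal_density x \<sigma> s * (s - x) ^ (2 * 1))"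
  have g: "integrable lborel (?g x)" "integral\<^sup>L lborel (?g x) = c" for x
  proof -
    have i: "integrable lborel (\<lambda>s. normal_density x \<sigma> s * (s - x) ^ (2 * 1))"
      using \<sigma>(1) by (rule integrable_normal_moment)
    show "integrable lborel (?g x)"
      using i \<sigma>(1) by (intro Bochner_Integration.integrable_add integrable_mult_right) auto
    have "integral\<^sup>L lborel (?g x) = c / 2 + D / r\<^sup>2 * (fact (2 * 1) / ((2 / \<sigma>\<^sup>2) ^ 1 * fact 1))"
      using i \<sigma>(1) integral_normal_moment_even[OF \<sigma>(1), of x 1]
      by (subst Bochner_Integration.integral_add) (auto simp del: mult_1_right)
    also have "\<dots> = c / 2 + D / r\<^sup>2 * \<sigma>\<^sup>2" by (simp add: fact_2)
    finally show "integral\<^sup>L lborel (?g x) = c" using \<sigma>(2) by simp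
  qed
  have le_g: "d (s - x) * normal_density x \<sigma> s \<le> ?g x s" for x s
    using mult_right_mono[OF le[of "s - x"], of "normal_density x \<sigma> s"]
    by (simp add: distrib_right distrib_left mult_ac)
  have int: "integrable lborel (\<lambda>s. d (s - x) * normal_density x \<sigma> s)" for x
  proof (rule Bochner_Integration.integrable_bound[OF g(1)])
    have "(\<lambda>s. d (s - x)) \<in> borel_measurable borel"
      by (intro borel_measurable_continuous_onI continuous_on_compose2[OF continuous] continuous_intros) auto
    then show "(\<lambda>s. d (s - x) * normal_density x \<sigma> s) \<in> borel_measurable lborel"
      by measurable
    show "AE s in lborel. norm (d (s - x) * normal_density x \<sigma> s) \<le> norm (?g x s)"
    proof (rule AE_I2)
      fix s
      have "norm (d (s - x) * normal_density x \<sigma> s) = d (s - x) * normal_density x \<sigma> s"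
        by simp
      also have "\<dots> \<le> norm (?g x s)" using le_g[of s x] unfolding real_norm_def by linarith
      finally show "norm (d (s - x) * normal_density x \<sigma> s) \<le> norm (?g x s)" .
    qed
  qed
  show ?thesis
  proof
    fix x
    show "(LINT s|lborel. d (s - x) * normal_density x \<sigma> s) \<le> c"
      using integral_mono[OF int g(1) le_g, of x] g(2) by simp
  qed (use \<sigma> int in auto)
qed

text \<open>The kernel smooths \<open>max 0 (e - d s)\<close> with a Gaussian so narrow that the
  mean of \<open>d (s - x)\<close> is at most \<open>c\<close>; that mean is the whole error in the
  concentration inequality. The lower bound holds because every \<open>s\<close> has some
  \<open>a\<close> in \<open>A\<close> with \<open>d (s - a) < e / 2\<close>, where the unsmoothed
  function is at least \<open>e / 2\<close>.\<close>

lemma exists_kernel: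
  assumes "0 < e"
  shows "\<exists>\<psi> q C M c A. almost_period_kernel d e \<psi> q C M c A"
proof -
  obtain A where A: "finite A" "\<And>t. \<exists>a\<in>A. d (t - a) < e / 2"
    using net[of "e / 2"] assms by auto
  have A_ne: "A \<noteq> {}" using A(2) by blast
  then have card: "0 < card A" using A(1) by (simp add: card_gt_0_iff)
  \<comment> \<open>Makes \<open>2 * c * card A\<close> equal to \<open>e / 2\<close>, the lower
    bound that the net provides.\<close>
  define c where "c = e / (4 * card A)"
  have c: "0 < c" "2 * c * card A = e / 2" using assms card by (auto simp: c_def)
  obtain \<sigma> where \<sigma>: "0 < \<sigma>" "\<And>x. integrable lborel (\<lambda>s. d (s - x) * normal_density x \<sigma> s)"
    "\<And>x. (LINT s|lborel. d (s - x) * normal_density x \<sigma> s) \<le> c"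
    using gaussian_mean_small[OF c(1)] by blast
  define \<phi> where "\<phi> s = max 0 (e - d s)" for s
  \<comment> \<open>The last inequality holds because \<phi> vanishes wherever \<open>d s\<close> is
    at least \<open>e\<close>.\<close>
  have \<phi>: "0 \<le> \<phi> s" "\<phi> s \<le> e" "\<phi> s * d s \<le> e * \<phi> s" for s
    using assms nonneg[of s] unfolding \<phi>_def
    by (auto simp: max_def mult.commute intro!: mult_right_mono)
  have cont\<phi>: "continuous_on UNIV \<phi>"
    unfolding \<phi>_def by (intro continuous_intros continuous)
  have cont\<phi>': "continuous_on UNIV (\<lambda>s. \<phi> (s + t))" for t
    by (intro continuous_on_compose2[OF cont\<phi>] continuous_intros) auto
  interpret smoothing \<sigma> e \<phi>
    by standard (use \<sigma> cont\<phi> \<phi> in auto)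
  define q where "q x = (LINT s|lborel. \<phi> s * normal_density x \<sigma> s)" for x
  define C where "C = exp (pi\<^sup>2 / (2 * \<sigma>\<^sup>2))"
  have C: "exp ((Im w)\<^sup>2 / (2 * \<sigma>\<^sup>2)) \<le> C" if "\<bar>Im w\<bar> \<le> pi" for w
    using that power_mono[OF that, of 2] by (auto simp: C_def intro!: divide_right_mono)
  have "almost_period_kernel d e (gaussian_smoothing \<sigma> \<phi>) q C (e * C) c A"
  proof unfold_locales
    show "gaussian_smoothing \<sigma> \<phi> holomorphic_on UNIV" by (rule holomorphic)
    show "gaussian_smoothing \<sigma> \<phi> (of_real s) = of_real (q s)" for s
      unfolding q_def by (rule smoothing_of_real)
    show "0 \<le> q s" for s
      unfolding q_def using \<phi>(1) by (intro integral_nonneg_AE AE_I2) auto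
    show "norm (gaussian_smoothing \<sigma> \<phi> w) \<le> e * C" if "\<bar>Im w\<bar> \<le> pi" for w
      by (rule order_trans[OF norm_le]) (use C[OF that] assms in \<open>auto intro: mult_left_mono\<close>)
    show "norm (gaussian_smoothing \<sigma> \<phi> (w + of_real t) - gaussian_smoothing \<sigma> \<phi> w) \<le> C * d t"
      if "\<bar>Im w\<bar> \<le> pi" for w t
    proof -
      interpret s': smoothing \<sigma> e "\<lambda>s. \<phi> (s + t)"
        by standard (use \<sigma> cont\<phi>' \<phi> in auto)
      \<comment> \<open>Truncation at 0 is 1-Lipschitz. The general bound for smoothings, applied to
        this increment with \<open>d t\<close> in place of \<open>e\<close>, gives the Lipschitz
        estimate.\<close>
      have \<phi>_diff: "\<bar>\<phi> (s + t) - \<phi> s\<bar> \<le> d t" for s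
        using diff_le[of "s + t" s] by (auto simp: \<phi>_def max_def)
      interpret diff: smoothing \<sigma> "d t" "\<lambda>s. \<phi> (s + t) - \<phi> s"
        by standard (use \<sigma> cont\<phi> cont\<phi>' \<phi>_diff in \<open>auto intro!: continuous_intros\<close>)
      have "gaussian_smoothing \<sigma> \<phi> (w + of_real t) - gaussian_smoothing \<sigma> \<phi> w
          = gaussian_smoothing \<sigma> (\<lambda>s. \<phi> (s + t) - \<phi> s) w"
        unfolding smoothing_add by (rule s'.smoothing_diff[symmetric]) unfold_locales
      also have "norm \<dots> \<le> d t * exp ((Im w)\<^sup>2 / (2 * \<sigma>\<^sup>2))"
        by (rule diff.norm_le)
      also have "\<dots> \<le> d t * C" by (intro mult_left_mono C that) auto
      finally show ?thesis by (simp add: mult.commute)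
    qed
    show "d x * q x \<le> e * (q x + c)" for x
    proof -
      have "d x * q x = (LINT s|lborel. d x * (\<phi> s * normal_density x \<sigma> s))"
        unfolding q_def by simp
      also have "\<dots> \<le> (LINT s|lborel. e * (\<phi> s * normal_density x \<sigma> s) +
          e * (d (s - x) * normal_density x \<sigma> s))"
      proof (rule integral_mono)
        show "integrable lborel (\<lambda>s. d x * (\<phi> s * normal_density x \<sigma> s))"
          using integrable_real by simp
        show "integrable lborel (\<lambda>s. e * (\<phi> s * normal_density x \<sigma> s) +
            e * (d (s - x) * normal_density x \<sigma> s))"
          using integrable_real \<sigma>(2) by simp
        fix s
        \<comment> \<open>Trades the length at the centre \<open>x\<close> for the length at the
          integration point \<open>s\<close>, where \<phi> controls it, plus an error small in
          Gaussian mean.\<close>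
        have "d x \<le> d s + d (s - x)"
          using subadd[of s "x - s"] minus[of "x - s"] by simp
        then have "\<phi> s * d x \<le> \<phi> s * d s + \<phi> s * d (s - x)"
          using \<phi>(1)[of s] by (simp add: distrib_left[symmetric] mult_left_mono)
        also have "\<dots> \<le> e * \<phi> s + e * d (s - x)"
          using \<phi> by (intro add_mono mult_right_mono) auto
        finally have "\<phi> s * d x * normal_density x \<sigma> s \<le> (e * \<phi> s + e * d (s - x)) * normal_density x \<sigma> s"
          by (intro mult_right_mono) auto
        then show "d x * (\<phi> s * normal_density x \<sigma> s)
            \<le> e * (\<phi> s * normal_density x \<sigma> s) + e * (d (s - x) * normal_density x \<sigma> s)"
          by (simp add: algebra_simps)
      qed
      also have "\<dots> = e * q x + e * (LINT s|lborel. d (s - x) * normal_density x \<sigma> s)"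
        using integrable_real \<sigma>(2) by (subst Bochner_Integration.integral_add) (auto simp: q_def)
      also have "\<dots> \<le> e * q x + e * c"
        using \<sigma>(3) assms by (intro add_left_mono mult_left_mono) auto
      finally show ?thesis by (simp add: distrib_left)
    qed
    show "2 * c * card A \<le> (\<Sum>a\<in>A. q (x - a))" for x
    proof -
      have q_shift: "q (x - a) = (LINT s|lborel. \<phi> (s - a) * normal_density x \<sigma> s)" for a
        unfolding q_def
        by (subst lborel_integral_real_affine[where c = 1 and t = "- a"])
           (simp_all add: normal_density_def add.commute)
      have int: "integrable lborel (\<lambda>s. \<phi> (s - a) * normal_density x \<sigma> s)" for a
      proof -
        interpret s': smoothing \<sigma> e "\<lambda>s. \<phi> (s + (- a))"
          by standard (use \<sigma> cont\<phi>'[of "- a"] \<phi> in auto)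
        show ?thesis using s'.integrable_real[of x] by simp
      qed
      have "e / 2 = (LINT s|lborel. e / 2 * normal_density x \<sigma> s)" using \<sigma>(1) by simp
      also have "\<dots> \<le> (LINT s|lborel. (\<Sum>a\<in>A. \<phi> (s - a) * normal_density x \<sigma> s))"
      proof (rule integral_mono)
        fix s
        obtain a where a: "a \<in> A" "d (s - a) < e / 2" using A(2) by blast
        have "e - d (s - a) \<le> \<phi> (s - a)" by (simp add: \<phi>_def)
        then have "e / 2 \<le> \<phi> (s - a)" using a(2) by simp
        also have "\<dots> \<le> (\<Sum>a\<in>A. \<phi> (s - a))"
          using A(1) a(1) \<phi>(1) by (intro member_le_sum) auto
        finally show "e / 2 * normal_density x \<sigma> s \<le> (\<Sum>a\<in>A. \<phi> (s - a) * normal_density x \<sigma> s)"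
          unfolding sum_distrib_right[symmetric] by (rule mult_right_mono) simp
      qed (use int \<sigma>(1) in auto)
      also have "\<dots> = (\<Sum>a\<in>A. q (x - a))"
        unfolding q_shift by (rule Bochner_Integration.integral_sum) (rule int)
      finally show ?thesis using c(2) by simp
    qed
  qed (use A A_ne c in \<open>auto simp: C_def\<close>)
  then show ?thesis by blast
qed

end

section \<open>Means of the kernel\<close>

text \<open>A primitive turns each integral into a difference of end values. Only two end
  displacements of size \<open>norm (p - p')\<close> remain, so the bound does not grow with
  \<open>L\<close>. Continuity up to the boundary is enough for the primitive, which allows paths
  along the edge of the strip.\<close>

lemma integral_horizontal_translate_bound:
  fixes h :: "complex \<Rightarrow> complex"
  assumes S: "convex S" "continuous_on S h" "h holomorphic_on interior S"
    and B: "\<And>w. w \<in> S \<Longrightarrow> norm (h w) \<le> B"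
    and L: "0 \<le> L" and p: "\<And>t. t \<in> {0..L} \<Longrightarrow> of_real t + p \<in> S" "\<And>t. t \<in> {0..L} \<Longrightarrow> of_real t + p' \<in> S"
  shows "norm (integral {0..L} (\<lambda>t. h (of_real t + p)) - integral {0..L} (\<lambda>t. h (of_real t + p')))
    \<le> 2 * B * norm (p - p')"
proof -
  obtain g where g: "\<And>x. x \<in> S \<Longrightarrow> (g has_field_derivative h x) (at x within S)"
  proof (rule holomorphic_convex_primitive[of S "{}" h])
    show "h field_differentiable at x" if "x \<in> interior S - {}" for x
      using that S(3) by (auto intro: holomorphic_on_imp_differentiable_at)
  qed (use S in auto)
  have I: "integral {0..L} (\<lambda>t. h (of_real t + r)) = g (of_real L + r) - g r"
    if r: "\<And>t. t \<in> {0..L} \<Longrightarrow> of_real t + r \<in> S" for r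
  proof -
    have "((\<lambda>t. h (of_real t + r)) has_integral (g \<circ> (\<lambda>t. of_real t + r)) L - (g \<circ> (\<lambda>t. of_real t + r)) 0) {0..L}"
    proof (rule fundamental_theorem_of_calculus[OF L])
      fix t assume t: "t \<in> {0..L}"
      have "((\<lambda>t. of_real t + r) has_vector_derivative 1) (at t within {0..L})"
        by (auto intro!: derivative_eq_intros has_vector_derivative_real_field[of "\<lambda>x. x + r", OF DERIV_cong])
      moreover have "(g has_field_derivative h (of_real t + r))
          (at (of_real t + r) within (\<lambda>t. of_real t + r) ` {0..L})"
        using r by (intro DERIV_subset[OF g[OF r[OF t]]]) auto
      ultimately show "(g \<circ> (\<lambda>t. of_real t + r) has_vector_derivative h (of_real t + r)) (at t within {0..L})"
        using field_vector_diff_chain_within by fastforce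
    qed
    then show ?thesis by (simp add: integral_unique)
  qed
  have "norm (g (of_real L + p) - g (of_real L + p')) \<le> B * norm (of_real L + p - (of_real L + p'))"
    using p[of L] L by (intro field_differentiable_bound[OF S(1) g B]) auto
  moreover have "norm (g p - g p') \<le> B * norm (p - p')"
    using p[of 0] L by (intro field_differentiable_bound[OF S(1) g B]) auto
  moreover have "norm (g (of_real L + p) - g p - (g (of_real L + p') - g p'))
      \<le> norm (g (of_real L + p) - g (of_real L + p')) + norm (g p - g p')"
    using norm_triangle_ineq4[of "g (of_real L + p) - g (of_real L + p')" "g p - g p'"]
    by (simp add: algebra_simps)
  ultimately show ?thesis
    using I[OF p(1)] I[OF p(2)] by simp
qed

context almost_period_kernel
begin

lemma \<psi>_continuous: "continuous_on S \<psi>"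
  using holomorphic holomorphic_on_imp_continuous_on continuous_on_subset by blast

lemma q_eq: "q s = Re (\<psi> (of_real s))"
  by (simp add: real)

lemma q_continuous [continuous_intros]:
  "continuous_on S f \<Longrightarrow> continuous_on S (\<lambda>x. q (f x))"
  unfolding q_eq by (intro continuous_intros continuous_on_compose2[OF \<psi>_continuous[of UNIV]]) auto

lemma q_lipschitz: "\<bar>q s - q t\<bar> \<le> C * d (s - t)"
  using lipschitz[of "of_real t" "s - t"]
  unfolding of_real_add[symmetric] real of_real_diff[symmetric] norm_of_real by simp

definition mean :: "real \<Rightarrow> real \<Rightarrow> real" where
  "mean L x = integral {0..L} (\<lambda>t. q (t - x)) / L"

text \<open>Up to an almost period, \<open>x\<close> may be replaced by some \<open>a\<close> from a
  finite set, changing the integrand by little. Translating by the bounded amount \<open>a\<close>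
  then changes the integral by at most \<open>2 * M * \<bar>a\<bar>\<close>, which is negligible
  after division by a large \<open>L\<close>.\<close>

lemma mean_uniform:
  assumes "0 < \<gamma>"
  obtains L\<^sub>0 where "\<And>L x. 0 < L \<Longrightarrow> L\<^sub>0 \<le> L \<Longrightarrow> \<bar>mean L x - mean L 0\<bar> \<le> \<gamma>"
proof -
  have M: "0 \<le> M" using bound[of 0] by (auto intro: order_trans[OF norm_ge_zero])
  \<comment> \<open>\<open>C + 1\<close> instead of \<open>C\<close> avoids division by
    zero.\<close>
  have "0 < \<gamma> / (2 * (C + 1))" using assms C_nonneg by simp
  from net[OF this] obtain E where E: "finite E" "\<And>t. \<exists>a\<in>E. d (t - a) < \<gamma> / (2 * (C + 1))"
    by auto
  define R where "R = (\<Sum>a\<in>E. \<bar>a\<bar>)"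
  have R: "\<bar>a\<bar> \<le> R" if "a \<in> E" for a
    unfolding R_def using E(1) that by (intro member_le_sum) auto
  show ?thesis
  proof
    fix L x :: real assume L: "0 < L" "4 * M * R / \<gamma> \<le> L"
    obtain a where a: "a \<in> E" "d (x - a) < \<gamma> / (2 * (C + 1))" using E(2) by blast
    have "norm (integral {0..L} (\<lambda>t. q (t - x)) - integral {0..L} (\<lambda>t. q (t - a)))
        = norm (integral {0..L} (\<lambda>t. q (t - x) - q (t - a)))"
      by (subst integral_diff) (auto intro!: integrable_continuous_interval continuous_intros)
    also have "\<dots> \<le> C * d (x - a) * (L - 0)"
    proof (rule integral_bound)
      show "norm (q (t - x) - q (t - a)) \<le> C * d (x - a)" for t
        using q_lipschitz[of "t - x" "t - a"] minus[of "x - a"] by simp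
    qed (use L in \<open>auto intro!: continuous_intros\<close>)
    also have "\<dots> \<le> \<gamma> / 2 * L"
    proof -
      have "C * d (x - a) \<le> (C + 1) * (\<gamma> / (2 * (C + 1)))"
        using a(2) C_nonneg by (intro mult_mono) auto
      also have "\<dots> = \<gamma> / 2" using C_nonneg by (simp add: field_simps)
      finally show ?thesis using L by (simp add: mult_right_mono)
    qed
    finally have 1: "\<bar>mean L x - mean L a\<bar> \<le> \<gamma> / 2"
      using L by (simp add: mean_def diff_divide_distrib[symmetric] pos_divide_le_eq)
    let ?S = "{w. \<bar>Im w\<bar> \<le> pi}"
    have S: "convex ?S"
    proof -
      have "?S = {w. Im w \<le> pi} \<inter> {w. - pi \<le> Im w}" by (auto simp: abs_le_iff)
      then show ?thesis
        using convex_halfspace_Im_le[of pi] convex_halfspace_Im_ge[of "- pi"] by (auto intro: convex_Int)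
    qed
    have \<psi>_int: "integral {0..L} (\<lambda>t. \<psi> (of_real t + of_real (- b))) = of_real (integral {0..L} (\<lambda>t. q (t - b)))" for b
    proof -
      have "((\<lambda>t. q (t - b)) has_integral integral {0..L} (\<lambda>t. q (t - b))) {0..L}"
        by (intro integrable_integral integrable_continuous_interval continuous_intros)
      then have "((\<lambda>t. of_real (q (t - b)) :: complex) has_integral of_real (integral {0..L} (\<lambda>t. q (t - b)))) {0..L}"
        by (rule has_integral_of_real)
      then show ?thesis
        by (intro integral_unique) (simp add: real flip: of_real_diff)
    qed
    have "norm (integral {0..L} (\<lambda>t. \<psi> (of_real t + of_real (- a))) -
        integral {0..L} (\<lambda>t. \<psi> (of_real t + of_real (- 0)))) \<le> 2 * M * norm (complex_of_real (- a) - of_real (- 0))"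
      by (rule integral_horizontal_translate_bound[OF S])
        (use L bound in \<open>auto intro: \<psi>_continuous holomorphic_on_subset[OF holomorphic]\<close>)
    then have "\<bar>integral {0..L} (\<lambda>t. q (t - a)) - integral {0..L} (\<lambda>t. q (t - 0))\<bar> \<le> 2 * M * \<bar>a\<bar>"
      unfolding \<psi>_int by (simp flip: of_real_diff of_real_minus)
    also have "\<dots> \<le> 2 * M * R" using R[OF a(1)] M by (intro mult_left_mono) auto
    also have "\<dots> \<le> \<gamma> / 2 * L" using L(2) assms by (simp add: field_simps)
    finally have "\<bar>mean L a - mean L 0\<bar> \<le> \<gamma> / 2"
      using L by (simp add: mean_def diff_divide_distrib[symmetric] pos_divide_le_eq)
    with 1 show "\<bar>mean L x - mean L 0\<bar> \<le> \<gamma>" by linarith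
  qed
qed

text \<open>Integrate \<open>lower\<close> over \<open>[0, L]\<close>: the means at the points of
  \<open>A\<close> average at least \<open>2 * c\<close>, and each exceeds \<open>mean L 0\<close>
  by at most \<open>c\<close>.\<close>

lemma mean_lower:
  assumes "0 < L" "\<And>x. \<bar>mean L x - mean L 0\<bar> \<le> c"
  shows "c \<le> mean L 0"
proof -
  have "2 * c * card A * L = integral {0..L} (\<lambda>t. 2 * c * card A)" using assms by simp
  also have "\<dots> \<le> integral {0..L} (\<lambda>t. \<Sum>a\<in>A. q (t - a))"
    using lower by (intro integral_le integrable_continuous_interval continuous_intros) auto
  also have "\<dots> = (\<Sum>a\<in>A. mean L a) * L"
    using assms(1) finite_A
    by (subst integral_sum) (auto intro!: integrable_continuous_interval continuous_intros
        simp: mean_def sum_divide_distrib[symmetric])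
  finally have "2 * c * card A \<le> (\<Sum>a\<in>A. mean L a)" using assms(1) by simp
  also have "\<dots> \<le> (\<Sum>a\<in>A. mean L 0 + c)"
    using assms(2) by (intro sum_mono) (smt (verit))
  finally have "card A * (2 * c) \<le> card A * (mean L 0 + c)" by (simp add: mult.commute)
  then show ?thesis
    using finite_A A_nonempty by (simp add: mult_le_cancel_left card_gt_0_iff)
qed

end

section \<open>The averaging operators\<close>

lemma apply_sum_bcontfun: "apply_bcontfun (\<Sum>j\<in>J. f j) z = (\<Sum>j\<in>J. apply_bcontfun (f j) z)"
  by (induction J rule: infinite_finite_induct) auto

lemma of_strip_Im: "0 \<le> Im (of_strip z)" "Im (of_strip z) \<le> pi"
  using of_strip[of z] by (auto simp: Sigma_strip_def)

lemma continuous_on_strip_function: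
  "continuous_on Sigma_strip (\<lambda>z. apply_bcontfun f (to_strip z))"
  by (rule continuous_on_compose2[OF continuous_on_apply_bcontfun continuous_on_to_strip]) auto

lemma continuous_on_horizontal [continuous_intros]:
  assumes "0 \<le> y" "y \<le> pi"
  shows "continuous_on S (\<lambda>t. apply_bcontfun f (to_strip (of_real t + \<i> * of_real y)))"
  by (rule continuous_on_compose2[OF continuous_on_strip_function])
     (use assms in \<open>auto simp: Sigma_strip_def intro!: continuous_intros\<close>)

lemma convex_strip: "convex Sigma_strip"
proof -
  have *: "Sigma_strip = {z. Im z \<le> pi} \<inter> {z. 0 \<le> Im z}" by (auto simp: Sigma_strip_def)
  show ?thesis
    unfolding * by (intro convex_Int convex_halfspace_Im_le convex_halfspace_Im_ge)
qed

lemma integral_subdivide: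
  fixes g :: "real \<Rightarrow> complex"
  assumes g: "continuous_on UNIV g" and "0 \<le> \<delta>"
  shows "integral {0..real n * \<delta>} g = (\<Sum>j<n. integral {real j * \<delta>..real (Suc j) * \<delta>} g)"
proof (induction n)
  case (Suc n)
  have "integral {0..real n * \<delta>} g + integral {real n * \<delta>..real (Suc n) * \<delta>} g = integral {0..real (Suc n) * \<delta>} g"
    using assms(2) by (intro Henstock_Kurzweil_Integration.integral_combine
        integrable_continuous_interval continuous_on_subset[OF g]) (auto simp: mult_right_mono)
  with Suc show ?case by simp
qed simp

section \<open>Kernel translates as elements of \<open>APH\<close>\<close>

context almost_period_kernel
begin

definition kernel_shift :: "real \<Rightarrow> strip \<Rightarrow>\<^sub>C complex" where
  "kernel_shift t = Bcontfun (\<lambda>z. \<psi> (of_real t - of_strip z))"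

lemma M_nonneg: "0 \<le> M"
  using bound[of 0] by (auto intro: order_trans[OF norm_ge_zero])

lemma apply_kernel_shift [simp]: "apply_bcontfun (kernel_shift t) z = \<psi> (of_real t - of_strip z)"
proof -
  have "(\<lambda>z. \<psi> (of_real t - of_strip z)) \<in> bcontfun"
  proof (rule bcontfun_normI)
    show "continuous_on UNIV (\<lambda>z. \<psi> (of_real t - of_strip z))"
      by (intro continuous_on_compose2[OF \<psi>_continuous[of UNIV]] continuous_intros) auto
    show "norm (\<psi> (of_real t - of_strip z)) \<le> M" for z
      using of_strip_Im[of z] by (intro bound) auto
  qed
  then show ?thesis by (simp add: kernel_shift_def Bcontfun_inverse)
qed

text \<open>Used twice: it transfers nets for \<open>d\<close> to orbits of kernel translates, and
  it controls the Riemann sum error.\<close>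

lemma dist_kernel_shift_le: "dist (kernel_shift s) (kernel_shift t) \<le> C * d (s - t)"
proof (rule dist_bound)
  fix z
  show "dist (apply_bcontfun (kernel_shift s) z) (apply_bcontfun (kernel_shift t) z) \<le> C * d (s - t)"
    using lipschitz[of "of_real t - of_strip z" "s - t"] of_strip_Im[of z]
    by (simp add: dist_norm)
qed

lemma shift_kernel_shift: "shift x (kernel_shift t) = kernel_shift (t - x)"
  by (rule bcontfun_eqI) (simp add: to_strip_inverse[OF of_strip_add_real] algebra_simps)

text \<open>The orbit consists of the functions \<open>kernel_shift (t - x)\<close>, so a net for
  \<open>d\<close> yields a finite net of kernel translates.\<close>

lemma kernel_shift_APH: "kernel_shift t \<in> APH"
proof -
  have "(\<lambda>z. \<psi> (of_real t - z)) holomorphic_on interior Sigma_strip"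
    using holomorphic_on_compose_gen[OF _ holomorphic, of "\<lambda>z. of_real t - z"]
    by (simp add: o_def holomorphic_intros)
  moreover have "\<psi> (of_real t - z) = apply_bcontfun (kernel_shift t) (to_strip z)"
    if "z \<in> interior Sigma_strip" for z
    using that interior_subset by (subst apply_kernel_shift, subst to_strip_inverse) auto
  ultimately have "(\<lambda>z. apply_bcontfun (kernel_shift t) (to_strip z)) holomorphic_on interior Sigma_strip"
    by (rule holomorphic_transform)
  moreover have "compact (closure (range (\<lambda>x. shift x (kernel_shift t))))"
    unfolding compact_closure_iff_totally_bounded
  proof (intro allI impI)
    fix r :: real assume r: "0 < r"
    then have "0 < r / (C + 1)" using C_nonneg by simp
    from net[OF this] obtain E where E: "finite E" "\<And>t. \<exists>a\<in>E. d (t - a) < r / (C + 1)"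
      by auto
    have "shift x (kernel_shift t) \<in> (\<Union>x\<in>kernel_shift ` E. ball x r)" for x
    proof -
      obtain a where a: "a \<in> E" "d (t - x - a) < r / (C + 1)" using E(2) by blast
      have "dist (kernel_shift (t - x)) (kernel_shift a) \<le> C * d (t - x - a)"
        by (rule dist_kernel_shift_le)
      also have "\<dots> \<le> (C + 1) * d (t - x - a)"
        by (rule mult_right_mono) auto
      also have "\<dots> < r"
        using a(2) C_nonneg by (simp add: field_simps)
      finally show ?thesis using a(1) by (auto simp: shift_kernel_shift dist_commute)
    qed
    then show "\<exists>k. finite k \<and> range (\<lambda>x. shift x (kernel_shift t)) \<subseteq> (\<Union>x\<in>k. ball x r)"
      using E(1) by blast
  qed
  ultimately show ?thesis by (simp add: APH_def)
qed

section \<open>The finite-rank operator and its comparison with a positive average\<close>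

definition real_trace :: "(strip \<Rightarrow>\<^sub>C complex) \<Rightarrow> real \<Rightarrow> complex" where
  "real_trace f t = apply_bcontfun f (to_strip (of_real t))"

lemma continuous_real_trace [continuous_intros]: "continuous_on S (real_trace f)"
  unfolding real_trace_def using continuous_on_horizontal[of 0] by simp

text \<open>A Riemann sum in which only the kernel is frozen, at the left end of each cell, while
  \<open>f\<close> is integrated exactly. The error thus involves no modulus of continuity of
  \<open>f\<close> and is uniform on bounded sets.\<close>

definition averaging :: "real \<Rightarrow> nat \<Rightarrow> (strip \<Rightarrow>\<^sub>C complex) \<Rightarrow> (strip \<Rightarrow>\<^sub>C complex)" where
  "averaging \<delta> n f = (\<Sum>j<n. (integral {real j * \<delta>..real (Suc j) * \<delta>} (real_trace f) / of_real (real n * \<delta>))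
     *\<^sub>C kernel_shift (real j * \<delta>))"

lemma averaging_add: "averaging \<delta> n (f + g) = averaging \<delta> n f + averaging \<delta> n g"
proof -
  have "integral {a..b} (real_trace (f + g)) = integral {a..b} (real_trace f) + integral {a..b} (real_trace g)" for a b
    by (subst integral_add[symmetric])
       (auto intro!: integrable_continuous_interval continuous_intros integral_cong simp: real_trace_def)
  then show ?thesis
    by (simp add: averaging_def add_divide_distrib scaleC_bcontfun.scale_left_distrib sum.distrib)
qed

lemma averaging_scaleC: "averaging \<delta> n (k *\<^sub>C f) = k *\<^sub>C averaging \<delta> n f"
proof -
  have "integral {a..b} (real_trace (k *\<^sub>C f)) = k * integral {a..b} (real_trace f)" for a b
  proof -
    have "real_trace (k *\<^sub>C f) = (\<lambda>t. k * real_trace f t)" by (simp add: real_trace_def fun_eq_iff)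
    then show ?thesis by simp
  qed
  then show ?thesis
    by (simp add: averaging_def scaleC_bcontfun.scale_sum_right)
qed

lemma averaging_APH: "averaging \<delta> n f \<in> APH"
  unfolding averaging_def
  by (intro scaleC_bcontfun.subspace_sum[OF subspace_APH]
      scaleC_bcontfun.subspace_scale[OF subspace_APH] kernel_shift_APH)

text \<open>The spanning set depends on \<delta> and \<open>n\<close> but not on \<open>f\<close>,
  which is what finite rank requires.\<close>

lemma averaging_span: "averaging \<delta> n f \<in> scaleC_bcontfun.span ((\<lambda>j. kernel_shift (real j * \<delta>)) ` {..<n})"
  unfolding averaging_def
  by (intro scaleC_bcontfun.span_sum scaleC_bcontfun.span_scale scaleC_bcontfun.span_base) auto

lemma averaging_riemann:
  assumes "0 < n" "0 < \<delta>" and \<theta>: "\<And>u. 0 \<le> u \<Longrightarrow> u \<le> \<delta> \<Longrightarrow> C * d u \<le> \<theta>"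
  shows "norm (apply_bcontfun (averaging \<delta> n f) z -
    integral {0..real n * \<delta>} (\<lambda>t. real_trace f t * \<psi> (of_real t - of_strip z)) / of_real (real n * \<delta>))
    \<le> norm f * \<theta>"
proof -
  let ?I = "\<lambda>j. {real j * \<delta>..real (Suc j) * \<delta>}"
  let ?b = "\<lambda>t. \<psi> (of_real t - of_strip z)"
  have cont: "continuous_on S ?b" for S
    by (intro continuous_on_compose2[OF \<psi>_continuous[of UNIV]] continuous_intros) auto
  have piece: "norm (integral (?I j) (real_trace f) * ?b (real j * \<delta>) - integral (?I j) (\<lambda>t. real_trace f t * ?b t))
      \<le> norm f * \<theta> * \<delta>" for j
  proof -
    have "integral (?I j) (real_trace f) * ?b (real j * \<delta>) - integral (?I j) (\<lambda>t. real_trace f t * ?b t)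
        = integral (?I j) (\<lambda>t. real_trace f t * (?b (real j * \<delta>) - ?b t))"
      unfolding right_diff_distrib
      by (subst integral_diff)
         (auto intro!: integrable_continuous_interval continuous_intros cont)
    also have "norm \<dots> \<le> norm f * \<theta> * (real (Suc j) * \<delta> - real j * \<delta>)"
    proof (rule integral_bound)
      fix t assume t: "t \<in> ?I j"
      have "norm (?b (real j * \<delta>) - ?b t) = dist (apply_bcontfun (kernel_shift t) z)
          (apply_bcontfun (kernel_shift (real j * \<delta>)) z)"
        by (simp add: dist_norm norm_minus_commute)
      also have "\<dots> \<le> C * d (t - real j * \<delta>)"
        using dist_bounded dist_kernel_shift_le by (rule order_trans)
      also have "\<dots> \<le> \<theta>"
        using t by (intro \<theta>) (auto simp: algebra_simps)
      finally show "norm (real_trace f t * (?b (real j * \<delta>) - ?b t)) \<le> norm f * \<theta>"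
        unfolding norm_mult by (intro mult_mono) (auto simp: real_trace_def norm_bounded)
    qed (use assms in \<open>auto intro!: continuous_intros cont simp: mult_right_mono\<close>)
    finally show ?thesis by (simp add: algebra_simps)
  qed
  have sum: "norm (\<Sum>j<n. integral (?I j) (real_trace f) * ?b (real j * \<delta>) - integral (?I j) (\<lambda>t. real_trace f t * ?b t))
      \<le> real n * (norm f * \<theta> * \<delta>)"
    by (rule order_trans[OF sum_norm_bound[OF piece]]) simp
  have "apply_bcontfun (averaging \<delta> n f) z - integral {0..real n * \<delta>} (\<lambda>t. real_trace f t * ?b t) / of_real (real n * \<delta>)
      = (\<Sum>j<n. integral (?I j) (real_trace f) * ?b (real j * \<delta>) - integral (?I j) (\<lambda>t. real_trace f t * ?b t)) / of_real (real n * \<delta>)"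
    using assms(2)
    by (subst integral_subdivide)
       (auto intro!: continuous_intros cont simp: averaging_def apply_sum_bcontfun sum_subtractf diff_divide_distrib sum_divide_distrib)
  also have "norm \<dots> \<le> (real n * (norm f * \<theta> * \<delta>)) / (real n * \<delta>)"
    unfolding norm_divide norm_of_real using assms(1,2) by (intro frac_le sum) (auto intro: order_trans[OF norm_ge_zero sum])
  also have "\<dots> = norm f * \<theta>" using assms by simp
  finally show ?thesis .
qed

text \<open>The path is raised from height 0 to the height of \<open>z\<close>, at most pi. There
  \<open>w - of_strip z\<close> is real, so the complex kernel becomes the nonnegative weight
  \<open>q\<close>; the cost is independent of \<open>L\<close>.\<close>

lemma averaging_contour:
  assumes f: "f \<in> APH" and L: "0 < L"
  shows "norm (integral {0..L} (\<lambda>t. real_trace f t * \<psi> (of_real t - of_strip z)) -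
    integral {0..L} (\<lambda>t. apply_bcontfun (shift (t - Re (of_strip z)) f) z * of_real (q (t - Re (of_strip z)))))
    \<le> 2 * pi * M * norm f"
proof -
  define x y where "x = Re (of_strip z)" and "y = Im (of_strip z)"
  have y: "0 \<le> y" "y \<le> pi" using of_strip_Im[of z] by (auto simp: y_def)
  have z: "of_strip z = of_real x + \<i> * of_real y" by (simp add: x_def y_def complex_eq)
  define h where "h w = apply_bcontfun f (to_strip w) * \<psi> (w - of_strip z)" for w
  have 1: "norm (integral {0..L} (\<lambda>t. h (of_real t + 0)) - integral {0..L} (\<lambda>t. h (of_real t + \<i> * of_real y)))
      \<le> 2 * (norm f * M) * norm (0 - \<i> * of_real y)"
  proof (rule integral_horizontal_translate_bound[OF convex_strip])
    show "continuous_on Sigma_strip h"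
      unfolding h_def by (intro continuous_intros continuous_on_strip_function
          continuous_on_compose2[OF \<psi>_continuous[of UNIV]]) auto
    show "h holomorphic_on interior Sigma_strip"
    proof -
      have "(\<lambda>w. \<psi> (w - of_strip z)) holomorphic_on interior Sigma_strip"
        using holomorphic_on_compose_gen[OF _ holomorphic, of "\<lambda>w. w - of_strip z"]
        by (simp add: o_def holomorphic_intros)
      then show ?thesis
        unfolding h_def using f by (auto intro!: holomorphic_on_mult simp: APH_def)
    qed
    show "norm (h w) \<le> norm f * M" if "w \<in> Sigma_strip" for w
      unfolding h_def norm_mult using that y
      by (intro mult_mono bound norm_bounded) (auto simp: Sigma_strip_def z)
  qed (use y L in \<open>auto simp: Sigma_strip_def\<close>)
  have "h (of_real t + \<i> * of_real y) = apply_bcontfun (shift (t - x) f) z * of_real (q (t - x))" for t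
  proof -
    have "of_strip z + of_real (t - x) = of_real t + \<i> * of_real y"
      "of_real t + \<i> * of_real y - of_strip z = of_real (t - x)"
      by (simp_all add: z)
    then show ?thesis by (simp only: h_def apply_shift real)
  qed
  moreover have "h (of_real t + 0) = real_trace f t * \<psi> (of_real t - of_strip z)" for t
    by (simp add: h_def real_trace_def)
  ultimately have "norm (integral {0..L} (\<lambda>t. real_trace f t * \<psi> (of_real t - of_strip z)) -
    integral {0..L} (\<lambda>t. apply_bcontfun (shift (t - x) f) z * of_real (q (t - x)))) \<le> 2 * (norm f * M) * y"
    using 1 y by (simp add: norm_mult)
  also have "\<dots> \<le> 2 * (norm f * M) * pi"
    using y M_nonneg by (intro mult_left_mono) auto
  finally show ?thesis by (simp add: x_def mult_ac)
qed

lemma continuous_shift_apply [continuous_intros]: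
  "continuous_on S (\<lambda>t. apply_bcontfun (shift (t - x) f) z)"
  unfolding apply_shift
  by (rule continuous_on_compose2[OF continuous_on_strip_function])
     (auto intro!: continuous_intros of_strip_add_real simp del: of_real_diff)

lemma averaging_estimate:
  assumes f: "f \<in> APH" and n: "0 < n" "0 < \<delta>"
    and \<theta>: "\<And>u. 0 \<le> u \<Longrightarrow> u \<le> \<delta> \<Longrightarrow> C * d u \<le> \<theta>"
  shows "norm (apply_bcontfun (averaging \<delta> n f) z -
      integral {0..real n * \<delta>} (\<lambda>t. apply_bcontfun (shift (t - Re (of_strip z)) f) z *
        of_real (q (t - Re (of_strip z)))) / of_real (real n * \<delta>))
    \<le> (\<theta> + 2 * pi * M / (real n * \<delta>)) * norm f"
proof -
  define L where "L = real n * \<delta>"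
  have L: "0 < L" using n by (simp add: L_def)
  define I J where "I = integral {0..L} (\<lambda>t. real_trace f t * \<psi> (of_real t - of_strip z))"
    and "J = integral {0..L} (\<lambda>t. apply_bcontfun (shift (t - Re (of_strip z)) f) z *
        of_real (q (t - Re (of_strip z))))"
  have "norm (I / of_real L - J / of_real L) \<le> 2 * pi * M * norm f / L"
    unfolding diff_divide_distrib[symmetric] norm_divide norm_of_real
    using averaging_contour[OF f L, of z] L by (simp add: I_def J_def divide_right_mono)
  moreover have "norm (apply_bcontfun (averaging \<delta> n f) z - I / of_real L) \<le> norm f * \<theta>"
    unfolding I_def L_def by (rule averaging_riemann[OF n \<theta>])
  ultimately have "norm (apply_bcontfun (averaging \<delta> n f) z - J / of_real L) \<le> norm f * \<theta> + 2 * pi * M * norm f / L"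
    using norm_triangle_ineq[of "apply_bcontfun (averaging \<delta> n f) z - I / of_real L" "I / of_real L - J / of_real L"]
    by simp
  moreover have "(\<theta> + 2 * pi * M / L) * norm f = norm f * \<theta> + 2 * pi * M * norm f / L"
    by (simp add: distrib_right distrib_left mult_ac)
  ultimately show ?thesis by (simp only: J_def L_def)
qed

text \<open>Nonnegativity of \<open>q\<close> is decisive: the norm of the average is bounded by the
  total weight itself, with no extra constant.\<close>

lemma average_norm_le:
  assumes "0 < L"
  shows "norm (integral {0..L} (\<lambda>t. apply_bcontfun (shift (t - x) f) z * of_real (q (t - x))) / of_real L)
    \<le> norm f * mean L x"
proof -
  have "norm (integral {0..L} (\<lambda>t. apply_bcontfun (shift (t - x) f) z * of_real (q (t - x))))
      \<le> integral {0..L} (\<lambda>t. norm f * q (t - x))"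
  proof (rule integral_norm_bound_integral)
    show "norm (apply_bcontfun (shift (t - x) f) z * of_real (q (t - x))) \<le> norm f * q (t - x)" for t
      using q_nonneg[of "t - x"] by (simp add: norm_mult norm_bounded mult_right_mono)
  qed (intro integrable_continuous_interval continuous_intros)+
  then show ?thesis
    using assms by (simp add: norm_divide mean_def divide_right_mono)
qed

text \<open>Where the shift moves \<open>f\<close> noticeably, \<open>d\<close> is large and
  \<open>concentrated\<close> makes the weight small; integrating that pointwise inequality gives
  the bound.\<close>

lemma average_concentrated:
  assumes "0 < L" and f: "\<And>s. norm (shift s f - f) \<le> d s"
  shows "norm (integral {0..L} (\<lambda>t. apply_bcontfun (shift (t - x) f) z * of_real (q (t - x))) / of_real L
      - of_real (mean L x) * apply_bcontfun f z) \<le> e * (mean L x + c)"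
proof -
  let ?S = "\<lambda>t. apply_bcontfun (shift (t - x) f) z"
  have int: "(\<lambda>t. ?S t * of_real (q (t - x))) integrable_on {0..L}"
    "(\<lambda>t. apply_bcontfun f z * of_real (q (t - x))) integrable_on {0..L}"
    "(\<lambda>t. q (t - x)) integrable_on {0..L}"
    by (intro integrable_continuous_interval continuous_intros)+
  have q: "integral {0..L} (\<lambda>t. apply_bcontfun f z * of_real (q (t - x)))
      = apply_bcontfun f z * of_real (mean L x * L)"
  proof -
    have "((\<lambda>t. q (t - x)) has_integral mean L x * L) {0..L}"
      using integrable_integral[OF int(3)] assms(1) by (simp add: mean_def)
    then have "((\<lambda>t. apply_bcontfun f z * of_real (q (t - x))) has_integral
        apply_bcontfun f z * of_real (mean L x * L)) {0..L}"
      by (intro has_integral_mult_right has_integral_of_real)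
    then show ?thesis by (rule integral_unique)
  qed
  have "norm (integral {0..L} (\<lambda>t. ?S t * of_real (q (t - x))) - apply_bcontfun f z * of_real (mean L x * L))
      = norm (integral {0..L} (\<lambda>t. ?S t * of_real (q (t - x)) - apply_bcontfun f z * of_real (q (t - x))))"
    unfolding q[symmetric] integral_diff[OF int(1,2)] ..
  also have "\<dots> \<le> integral {0..L} (\<lambda>t. e * (q (t - x) + c))"
  proof (rule integral_norm_bound_integral)
    fix t
    have "norm (?S t - apply_bcontfun f z) \<le> d (t - x)"
      using norm_bounded[of "shift (t - x) f - f" z] f[of "t - x"] by simp
    then have "norm (?S t - apply_bcontfun f z) * q (t - x) \<le> d (t - x) * q (t - x)"
      using q_nonneg by (rule mult_right_mono)
    also have "\<dots> \<le> e * (q (t - x) + c)" by (rule concentrated)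
    finally show "norm (?S t * of_real (q (t - x)) - apply_bcontfun f z * of_real (q (t - x))) \<le> e * (q (t - x) + c)"
      unfolding left_diff_distrib[symmetric] norm_mult norm_of_real using q_nonneg by simp
  qed (intro integrable_diff int integrable_continuous_interval continuous_intros)+
  also have "\<dots> = e * (mean L x + c) * L"
  proof -
    have "((\<lambda>t. e * (q (t - x) + c)) has_integral e * (mean L x * L + L * c)) {0..L}"
      using has_integral_add[OF integrable_integral[OF int(3)] has_integral_const_real[of c 0 L]] assms(1)
      by (intro has_integral_mult_right) (simp add: mean_def)
    then show ?thesis by (simp add: integral_unique algebra_simps)
  qed
  finally have "norm (integral {0..L} (\<lambda>t. ?S t * of_real (q (t - x))) - apply_bcontfun f z * of_real (mean L x * L)) / L
      \<le> e * (mean L x + c)"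
    using assms(1) by (simp add: pos_divide_le_eq)
  moreover have "integral {0..L} (\<lambda>t. ?S t * of_real (q (t - x))) / of_real L - of_real (mean L x) * apply_bcontfun f z
     = (integral {0..L} (\<lambda>t. ?S t * of_real (q (t - x))) - apply_bcontfun f z * of_real (mean L x * L)) / of_real L"
    using assms(1) by (simp add: field_simps)
  ultimately show ?thesis
    using assms(1) by (simp only: norm_divide norm_of_real abs_of_pos)
qed

end

text \<open>The normaliser \<kappa> lies slightly above all the means, so that dividing by it later
  gives norm at most 1 exactly, yet close enough to them that functions in \<open>F\<close> are
  nearly fixed.\<close>

lemma (in almost_period_kernel) exists_almost_identity:
  assumes F: "F \<subseteq> APH" "\<And>f s. f \<in> F \<Longrightarrow> norm (shift s f - f) \<le> d s"
    and X: "\<And>f. f \<in> F \<Longrightarrow> norm f \<le> X" and e: "0 < e"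
  shows "\<exists>\<kappa> \<delta> n. 0 < \<kappa> \<and> (\<forall>f\<in>APH. norm (averaging \<delta> n f) \<le> \<kappa> * norm f) \<and>
    (\<forall>f\<in>F. norm (averaging \<delta> n f - of_real \<kappa> *\<^sub>C f) \<le> 4 * e * \<kappa>)"
proof -
  define Y where "Y = max 1 X"
  \<comment> \<open>A common error budget: \<open>r \<le> c\<close> secures the lower bound on the
    mean, and \<open>r * Y \<le> c * e\<close> bounds errors proportional to \<open>norm f\<close>
    on \<open>F\<close>.\<close>
  define r where "r = c * min 1 (e / Y)"
  have r: "0 < r" "r \<le> c" "r * Y \<le> c * e"
  proof -
    have Y: "1 \<le> Y" by (simp add: Y_def)
    then show "0 < r" using c_pos e by (simp add: r_def)
    show "r \<le> c" using c_pos by (simp add: r_def)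
    have "r * Y \<le> c * (e / Y) * Y"
      unfolding r_def using c_pos Y by (intro mult_right_mono mult_left_mono) auto
    then show "r * Y \<le> c * e" using Y by simp
  qed
  obtain L\<^sub>0 where L\<^sub>0: "\<And>L x. 0 < L \<Longrightarrow> L\<^sub>0 \<le> L \<Longrightarrow> \<bar>mean L x - mean L 0\<bar> \<le> r / 3"
    using mean_uniform[of "r / 3"] r(1) by auto
  \<comment> \<open>Large enough for nearly constant means and for a contour error of at most
    \<open>r / 3\<close>; the 1 ensures positivity.\<close>
  define L where "L = max (max 1 L\<^sub>0) (6 * pi * M / r)"
  have L: "0 < L" "L\<^sub>0 \<le> L" "2 * pi * M / L \<le> r / 3"
  proof -
    show "0 < L" "L\<^sub>0 \<le> L" by (auto simp: L_def)
    have "6 * pi * M / r \<le> L" by (simp add: L_def)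
    then show "2 * pi * M / L \<le> r / 3" using r(1) \<open>0 < L\<close> by (simp add: field_simps)
  qed
  have mean_L: "\<bar>mean L x - mean L 0\<bar> \<le> r / 3" for x
    using L\<^sub>0 L by blast
  have c_le: "c \<le> mean L 0"
    using order_trans[OF mean_L] r by (intro mean_lower L) auto
  have "\<forall>\<^sub>F u in at 0. dist (d u) 0 < r / (3 * (C + 1))"
    using tendsto_zero r(1) C_nonneg by (intro tendstoD) auto
  then obtain \<rho> where \<rho>: "0 < \<rho>" "\<And>u. u \<noteq> 0 \<Longrightarrow> \<bar>u\<bar> < \<rho> \<Longrightarrow> d u < r / (3 * (C + 1))"
    unfolding eventually_at by (auto simp: dist_norm)
  obtain n where n: "L / \<rho> < real n" using reals_Archimedean2 by blast
  then have n0: "0 < n" using L(1) \<rho>(1) by (metis divide_pos_pos of_nat_0_less_iff order_less_trans)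
  define \<delta> where "\<delta> = L / n"
  have \<delta>: "0 < \<delta>" "\<delta> < \<rho>" "real n * \<delta> = L"
    using n n0 L(1) \<rho>(1) by (auto simp: \<delta>_def field_simps)
  have \<theta>: "C * d u \<le> r / 3" if "0 \<le> u" "u \<le> \<delta>" for u
  proof -
    have "d u \<le> r / (3 * (C + 1))"
      using \<rho>(2)[of u] that \<delta>(2) r(1) C_nonneg by (cases "u = 0") auto
    then have "C * d u \<le> (C + 1) * (r / (3 * (C + 1)))"
      using C_nonneg by (intro mult_mono) auto
    moreover have "k * (r / (3 * k)) = r / 3" if "k \<noteq> 0" for k using that by simp
    ultimately show ?thesis using C_nonneg by (metis add_nonneg_pos less_irrefl zero_less_one)
  qed
  \<comment> \<open>The surplus \<open>r\<close> absorbs \<open>r / 3\<close> each from the Riemann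
    sum, the contour shift and the variation of the mean.\<close>
  define \<kappa> where "\<kappa> = mean L 0 + r"
  have \<kappa>: "0 < \<kappa>" "c \<le> \<kappa>" using c_le c_pos r by (auto simp: \<kappa>_def)
  define J where "J f z = integral {0..L} (\<lambda>t. apply_bcontfun (shift (t - Re (of_strip z)) f) z *
        of_real (q (t - Re (of_strip z)))) / of_real L" for f z
  have main: "norm (apply_bcontfun (averaging \<delta> n f) z - J f z) \<le> 2 * r / 3 * norm f" if "f \<in> APH" for f z
  proof -
    have "norm (apply_bcontfun (averaging \<delta> n f) z - J f z) \<le> (r / 3 + 2 * pi * M / L) * norm f"
      using averaging_estimate[OF that n0 \<delta>(1) \<theta>, of z] unfolding J_def \<delta>(3) .
    also have "\<dots> \<le> (2 * r / 3) * norm f"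
      using L(3) by (intro mult_right_mono) auto
    finally show ?thesis .
  qed
  show ?thesis
  proof (rule exI[of _ \<kappa>], rule exI[of _ \<delta>], rule exI[of _ n], intro conjI ballI)
    show "0 < \<kappa>" by (rule \<kappa>)
    fix f assume f: "f \<in> APH"
    show "norm (averaging \<delta> n f) \<le> \<kappa> * norm f"
    proof (rule norm_bound)
      fix z
      have "norm (J f z) \<le> norm f * mean L (Re (of_strip z))"
        unfolding J_def by (rule average_norm_le[OF L(1)])
      also have "\<dots> \<le> norm f * (mean L 0 + r / 3)"
        using mean_L[of "Re (of_strip z)"] by (intro mult_left_mono norm_ge_zero) linarith
      finally have "norm (J f z) \<le> norm f * (mean L 0 + r / 3)" .
      moreover have "norm (apply_bcontfun (averaging \<delta> n f) z) \<le>
          norm (apply_bcontfun (averaging \<delta> n f) z - J f z) + norm (J f z)"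
        by (metis diff_add_cancel norm_triangle_ineq)
      ultimately show "norm (apply_bcontfun (averaging \<delta> n f) z) \<le> \<kappa> * norm f"
        using main[OF f, of z] by (simp add: \<kappa>_def algebra_simps)
    qed
  next
    fix f assume f: "f \<in> F"
    then have f': "f \<in> APH" using F by auto
    show "norm (averaging \<delta> n f - of_real \<kappa> *\<^sub>C f) \<le> 4 * e * \<kappa>"
    proof (rule norm_bound)
      fix z
      let ?m = "mean L (Re (of_strip z))"
      have "norm (apply_bcontfun (averaging \<delta> n f) z - of_real \<kappa> * apply_bcontfun f z)
          \<le> norm (apply_bcontfun (averaging \<delta> n f) z - J f z)
            + norm (J f z - of_real ?m * apply_bcontfun f z)
            + norm (of_real ?m * apply_bcontfun f z - of_real \<kappa> * apply_bcontfun f z)"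
        by (intro norm_diff_triangle_le[where y = "of_real ?m * apply_bcontfun f z"]
            norm_diff_triangle_le[where y = "J f z"] order_refl)
      \<comment> \<open>The three terms are the operator error, the concentration error, and the gap
        between the local mean and \<kappa>, at most \<open>r / 3 + r\<close>.\<close>
      also have "\<dots> \<le> 2 * r / 3 * norm f + e * (\<kappa> + c) + 4 * r / 3 * norm f"
      proof (intro add_mono)
        show "norm (apply_bcontfun (averaging \<delta> n f) z - J f z) \<le> 2 * r / 3 * norm f"
          by (rule main[OF f'])
        have "norm (J f z - of_real ?m * apply_bcontfun f z) \<le> e * (?m + c)"
          unfolding J_def by (rule average_concentrated[OF L(1) F(2)[OF f]])
        also have "\<dots> \<le> e * (\<kappa> + c)"
          unfolding \<kappa>_def using mean_L[of "Re (of_strip z)"] r(1) e by (intro mult_left_mono) linarith+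
        finally show "norm (J f z - of_real ?m * apply_bcontfun f z) \<le> e * (\<kappa> + c)" .
        have "norm (of_real ?m * apply_bcontfun f z - of_real \<kappa> * apply_bcontfun f z)
            = \<bar>?m - \<kappa>\<bar> * norm (apply_bcontfun f z)"
          by (simp add: norm_mult flip: left_diff_distrib of_real_diff)
        also have "\<dots> \<le> 4 * r / 3 * norm f"
        proof (rule mult_mono)
          show "\<bar>?m - \<kappa>\<bar> \<le> 4 * r / 3"
            unfolding \<kappa>_def using mean_L[of "Re (of_strip z)"] r(1) by linarith
        qed (use r(1) in \<open>auto simp: norm_bounded\<close>)
        finally show "norm (of_real ?m * apply_bcontfun f z - of_real \<kappa> * apply_bcontfun f z) \<le> 4 * r / 3 * norm f" .
      qed
      also have "\<dots> = 2 * (r * norm f) + e * (\<kappa> + c)" by (simp add: field_simps)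
      also have "\<dots> \<le> 2 * (c * e) + e * (\<kappa> + c)"
      proof -
        have "r * norm f \<le> r * Y" using X[OF f] r(1) by (intro mult_left_mono) (auto simp: Y_def)
        then show ?thesis using r(3) by linarith
      qed
      also have "\<dots> \<le> 4 * e * \<kappa>"
        using mult_left_mono[OF \<kappa>(2), of e] e by (simp add: algebra_simps)
      finally show "norm (apply_bcontfun (averaging \<delta> n f - of_real \<kappa> *\<^sub>C f) z) \<le> 4 * e * \<kappa>"
        by simp
    qed
  qed
qed

section \<open>Normalisation, and passage from a finite net to the compact set\<close>

theorem proposition3p1:
  shows "metric_approximation_property scaleC_bcontfun APH"
  unfolding metric_approximation_property_def
proof (intro allI impI)
  fix K :: "(strip \<Rightarrow>\<^sub>C complex) set" and \<epsilon> :: real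
  assume "compact K \<and> K \<subseteq> APH \<and> 0 < \<epsilon>"
  then have K: "compact K" "K \<subseteq> APH" and \<epsilon>: "0 < \<epsilon>" by auto
  \<comment> \<open>The final error splits as \<open>e + 4 * e + e\<close>.\<close>
  define e where "e = \<epsilon> / 6"
  have e: "0 < e" using \<epsilon> by (simp add: e_def)
  have "K \<subseteq> (\<Union>f\<in>K. ball f e)" using e by auto
  then obtain F where F: "F \<subseteq> K" "finite F" "K \<subseteq> (\<Union>f\<in>F. ball f e)"
    by (rule compactE_image[OF K(1) open_ball])
  have FA: "F \<subseteq> APH" using F(1) K(2) by (rule order_trans)
  define d where "d s = (\<Sum>f\<in>F. norm (shift s f - f))" for s
  interpret almost_period_length d
    unfolding d_def using F(2) FA by (rule almost_period_length_APH)
  obtain \<psi> q C M c A where "almost_period_kernel d e \<psi> q C M c A"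
    using exists_kernel[OF e] by blast
  then interpret almost_period_kernel d e \<psi> q C M c A .
  have F_d: "norm (shift s f - f) \<le> d s" if "f \<in> F" for f s
    unfolding d_def using F(2) that by (intro member_le_sum) auto
  have F_X: "norm f \<le> (\<Sum>f\<in>F. norm f)" if "f \<in> F" for f
    using F(2) that by (intro member_le_sum) auto
  obtain \<kappa> \<delta> n where \<kappa>: "0 < \<kappa>" "\<And>f. f \<in> APH \<Longrightarrow> norm (averaging \<delta> n f) \<le> \<kappa> * norm f"
    "\<And>f. f \<in> F \<Longrightarrow> norm (averaging \<delta> n f - of_real \<kappa> *\<^sub>C f) \<le> 4 * e * \<kappa>"
    using exists_almost_identity[OF FA F_d F_X e] by blast
  define T where "T f = of_real (1 / \<kappa>) *\<^sub>C averaging \<delta> n f" for f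
  have T_norm: "norm (T f) \<le> norm f" if "f \<in> APH" for f
    using \<kappa>(1) \<kappa>(2)[OF that] unfolding T_def norm_scaleC_bcontfun
    by (simp add: norm_divide pos_divide_le_eq mult.commute)
  have T_add: "T (f + g) = T f + T g" for f g
    by (simp add: T_def averaging_add scaleC_bcontfun.scale_right_distrib)
  have T_F: "norm (T f - f) \<le> 4 * e" if "f \<in> F" for f
  proof -
    have eq: "T f - f = of_real (1 / \<kappa>) *\<^sub>C (averaging \<delta> n f - of_real \<kappa> *\<^sub>C f)"
      using \<kappa>(1) by (simp add: T_def scaleC_bcontfun.scale_right_diff_distrib)
    show ?thesis
      using \<kappa>(1) \<kappa>(3)[OF that] unfolding eq norm_scaleC_bcontfun
      by (simp add: norm_divide pos_divide_le_eq)
  qed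
  show "\<exists>T. T ` APH \<subseteq> APH \<and> (\<forall>x\<in>APH. \<forall>y\<in>APH. T (x + y) = T x + T y) \<and>
      (\<forall>c. \<forall>x\<in>APH. T (c *\<^sub>C x) = c *\<^sub>C T x) \<and>
      (\<exists>F. finite F \<and> T ` APH \<subseteq> scaleC_bcontfun.span F) \<and>
      (\<forall>x\<in>APH. norm (T x) \<le> norm x) \<and> (\<forall>x\<in>K. norm (T x - x) \<le> \<epsilon>)"
  proof (intro exI[of _ T] conjI ballI allI)
    show "T ` APH \<subseteq> APH"
      unfolding T_def by (auto intro: scaleC_bcontfun.subspace_scale[OF subspace_APH] averaging_APH)
    show "T (x + y) = T x + T y" for x y by (rule T_add)
    show "T (k *\<^sub>C x) = k *\<^sub>C T x" for k x
      by (simp add: T_def averaging_scaleC mult.commute)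
    show "\<exists>F. finite F \<and> T ` APH \<subseteq> scaleC_bcontfun.span F"
      by (intro exI[of _ "(\<lambda>j. kernel_shift (real j * \<delta>)) ` {..<n}"])
         (auto simp: T_def intro: scaleC_bcontfun.span_scale averaging_span)
    show "norm (T x) \<le> norm x" if "x \<in> APH" for x by (rule T_norm[OF that])
    fix x assume x: "x \<in> K"
    then obtain f where f: "f \<in> F" "dist f x < e" using F(3) by auto
    have xf: "x - f \<in> APH"
      using scaleC_bcontfun.subspace_diff[OF subspace_APH] x f(1) K(2) FA by auto
    \<comment> \<open>Additivity and the norm bound 1 carry the estimate from the net point
      \<open>f\<close> to \<open>x\<close>, each replacement costing at most
      \<open>e\<close>.\<close>
    have "T x - x = T (x - f) + (T f - f) + (f - x)"
      using T_add[of "x - f" f] by simp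
    also have "norm \<dots> \<le> norm (T (x - f)) + norm (T f - f) + norm (f - x)"
      by (intro order_trans[OF norm_triangle_ineq] add_right_mono norm_triangle_ineq)
    also have "\<dots> \<le> e + 4 * e + e"
      using T_norm[OF xf] T_F[OF f(1)] f(2) by (simp add: dist_norm norm_minus_commute)
    finally show "norm (T x - x) \<le> \<epsilon>" by (simp add: e_def)
  qed
qed

end
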